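(* Let $\sigma_1,\dots,\sigma_k$ be non-crossing partitions and let $p$ be a permutation of $\{1,\dots,k\}$. Then $\sigma_1[\sigma_2]\cdots[\sigma_k]$ and $\sigma_{p(1)}[\sigma_{p(2)}]\cdots[\sigma_{p(k)}]$ are cc-equivalent.
   Context: Set partitions are written in canonical sequential form (restricted growth words). A partition is non-crossing if it avoids the pattern $1212$ (pattern containment = having a subsequence order-isomorphic to the pattern). For partitions $\alpha,\beta$, $\alpha[\beta]$ is the concatenation of $\alpha$ with $\beta+r$, $r$ the number of blocks of $\alpha$ (adding $r$ to every letter of $\beta$); this operation is associative. A partition is connected if it cannot be written as $\alpha[\beta]$ with $\alpha,\beta$ nonempty; the components of $\pi$ are the unique nonempty connected $\sigma_i$ with $\pi=\sigma_1[\sigma_2]\cdots[\sigma_m]$. Two non-crossing patterns $\sigma,\tau$ are cc-equivalent if there is a bijection from the set of partitions avoiding both $1212$ and $\sigma$ to the set of partitions avoiding both $1212$ and $\tau$ that preserves size and number of components. *)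

theory Defs
  imports "HOL-Combinatorics.Permutations"
begin

text \<open>Set partitions in canonical sequential form (restricted growth words),
  letters are positive naturals starting with 1.\<close>

definition nblocks :: "nat list \<Rightarrow> nat" where
  "nblocks w = Max (insert 0 (set w))"

definition is_partition :: "nat list \<Rightarrow> bool" where
  "is_partition w \<longleftrightarrow>
     (\<forall>i < length w. 1 \<le> w ! i \<and> w ! i \<le> nblocks (take i w) + 1)"

definition contains :: "nat list \<Rightarrow> nat list \<Rightarrow> bool" where
  "contains w p \<longleftrightarrow>
     (\<exists>is. length is = length p \<and> sorted_wrt (<) is \<and> (\<forall>i\<in>set is. i < length w) \<and>
        (\<forall>a < length p. \<forall>b < length p. (w ! (is ! a) \<le> w ! (is ! b)) \<longleftrightarrow> (p ! a \<le> p ! b)))"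

definition avoids :: "nat list \<Rightarrow> nat list \<Rightarrow> bool" where
  "avoids w p \<longleftrightarrow> \<not> contains w p"

definition noncrossing :: "nat list \<Rightarrow> bool" where
  "noncrossing w \<longleftrightarrow> is_partition w \<and> avoids w [1,2,1,2]"

definition bracket :: "nat list \<Rightarrow> nat list \<Rightarrow> nat list" where
  "bracket \<alpha> \<beta> = \<alpha> @ map (\<lambda>x. x + nblocks \<alpha>) \<beta>"

text \<open>sigma_1[sigma_2]...[sigma_m] (the operation is associative; we bracket from the left).\<close>
definition iter_bracket :: "nat list list \<Rightarrow> nat list" where
  "iter_bracket \<sigma>s = foldl bracket [] \<sigma>s"

definition connected :: "nat list \<Rightarrow> bool" where
  "connected \<pi> \<longleftrightarrow> \<not> (\<exists>\<alpha> \<beta>. is_partition \<alpha> \<and> is_partition \<beta> \<and> \<alpha> \<noteq> [] \<and> \<beta> \<noteq> [] \<and> \<pi> = bracket \<alpha> \<beta>)"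

definition components :: "nat list \<Rightarrow> nat list list" where
  "components \<pi> = (THE cs. (\<forall>c\<in>set cs. is_partition c \<and> c \<noteq> [] \<and> connected c) \<and> iter_bracket cs = \<pi>)"

definition ncomponents :: "nat list \<Rightarrow> nat" where
  "ncomponents \<pi> = length (components \<pi>)"

definition Av_nc :: "nat list \<Rightarrow> nat list set" where
  "Av_nc \<sigma> = {\<pi>. is_partition \<pi> \<and> avoids \<pi> [1,2,1,2] \<and> avoids \<pi> \<sigma>}"

definition cc_equivalent :: "nat list \<Rightarrow> nat list \<Rightarrow> bool" where
  "cc_equivalent \<sigma> \<tau> \<longleftrightarrow>
     (\<exists>f. bij_betw f (Av_nc \<sigma>) (Av_nc \<tau>) \<and>
        (\<forall>\<pi>\<in>Av_nc \<sigma>. length (f \<pi>) = length \<pi> \<and> ncomponents (f \<pi>) = ncomponents \<pi>))"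

end

theory Submission
  imports Defs "HOL-Library.Sublist"
begin

text \<open>For a non-crossing word \<open>w\<close> let \<open>low x w\<close> be the prefix before the first letter above
  \<open>x\<close>, and \<open>high x w\<close> the subword of the letters above \<open>x\<close>. Then \<open>w\<close> contains
  \<open>bracket \<alpha> \<beta>\<close> iff for some \<open>x\<close> the word \<open>low x w\<close> contains \<open>\<alpha>\<close> and \<open>high x w\<close>
  contains \<open>\<beta>\<close>. As \<open>x\<close> grows, avoidance of \<open>\<alpha>\<close> by \<open>low x w\<close> can only be lost and avoidance
  of \<open>\<beta>\<close> by \<open>high x w\<close> only be gained, so an Euler characteristic argument expresses the number
  of avoiders of \<open>bracket \<alpha> \<beta>\<close> by the numbers of avoiders of \<open>\<alpha>\<close> and of \<open>\<beta>\<close>, by the number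
  of pairs \<open>(w, x)\<close> such that \<open>low x w\<close> avoids \<open>\<alpha>\<close> and \<open>high x w\<close> avoids \<open>\<beta>\<close>, and by the
  number of pairs such that \<open>low x w\<close> avoids \<open>\<alpha>\<close> and \<open>high (x + 1) w\<close> avoids \<open>\<beta>\<close>.

  Non-crossing partitions correspond to ordered forests, components to trees and blocks to leaves.
  The pairs of the first kind become cuts of a forest at a gap between siblings, those of the second
  kind cuts at a leaf. A cut is determined by its left part, its right part and the numbers of left
  and right siblings along a path. Exchanging left and right in these numbers shows that the counts
  are symmetric in \<open>\<alpha>\<close> and \<open>\<beta>\<close>, and they depend only on how many avoiders of each size and
  number of components there are. Hence \<open>bracket\<close> is commutative and congruent up to
  cc-equivalence.\<close>

section \<open>Patterns and subsequences\<close>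

definition order_iso :: "nat list \<Rightarrow> nat list \<Rightarrow> bool" where
  "order_iso v p \<longleftrightarrow> length v = length p \<and>
     (\<forall>a < length p. \<forall>b < length p. v ! a \<le> v ! b \<longleftrightarrow> p ! a \<le> p ! b)"

lemma subseq_imp_index_list:
  assumes "subseq v w"
  shows "\<exists>is. sorted_wrt (<) is \<and> (\<forall>i\<in>set is. i < length w) \<and> v = map ((!) w) is"
  using assms
proof (induction rule: list_emb.induct)
  case (list_emb_Nil ys)
  show ?case by (rule exI[of _ "[]"]) simp
next
  case (list_emb_Cons xs ys y)
  then obtain ks where "sorted_wrt (<) ks" "\<forall>i\<in>set ks. i < length ys" "xs = map ((!) ys) ks"
    by blast
  then show ?case
    by (intro exI[of _ "map Suc ks"]) (auto simp: sorted_wrt_map)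
next
  case (list_emb_Cons2 x y xs ys)
  then obtain ks where "sorted_wrt (<) ks" "\<forall>i\<in>set ks. i < length ys" "xs = map ((!) ys) ks"
    by blast
  with list_emb_Cons2 show ?case
    by (intro exI[of _ "0 # map Suc ks"]) (auto simp: sorted_wrt_map)
qed

lemma index_list_imp_subseq:
  assumes "sorted_wrt (<) is" "\<forall>i\<in>set is. i < length w"
  shows "subseq (map ((!) w) is) w"
proof -
  have "subseq is [0..<length w]"
    using assms by (intro sorted_subset_imp_subseq) (auto simp: strict_sorted_iff)
  then have "subseq (map ((!) w) is) (map ((!) w) [0..<length w])"
    by (rule subseq_map)
  then show ?thesis by (simp add: map_nth)
qed

text \<open>Separates the choice of positions from the comparison of letters, so that the theory of
  \<open>subseq\<close> replaces index lists from here on.\<close>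

lemma contains_iff_subseq: "contains w p \<longleftrightarrow> (\<exists>v. subseq v w \<and> order_iso v p)"
proof
  assume "contains w p"
  then obtain ks where ks: "length ks = length p" "sorted_wrt (<) ks" "\<forall>i\<in>set ks. i < length w"
    "\<forall>a < length p. \<forall>b < length p. (w ! (ks ! a) \<le> w ! (ks ! b)) \<longleftrightarrow> (p ! a \<le> p ! b)"
    unfolding contains_def by blast
  then show "\<exists>v. subseq v w \<and> order_iso v p"
    by (intro exI[of _ "map ((!) w) ks"] conjI index_list_imp_subseq) (auto simp: order_iso_def)
next
  assume "\<exists>v. subseq v w \<and> order_iso v p"
  then obtain v where v: "subseq v w" "order_iso v p" by blast
  from subseq_imp_index_list[OF v(1)] obtain ks where
    "sorted_wrt (<) ks" "\<forall>i\<in>set ks. i < length w" "v = map ((!) w) ks" by blast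
  with v(2) show "contains w p"
    unfolding contains_def order_iso_def by (intro exI[of _ ks]) auto
qed

lemma contains_Nil [simp]: "contains w []"
  by (auto simp: contains_iff_subseq order_iso_def)

lemma contains_subseq: "contains v p \<Longrightarrow> subseq v w \<Longrightarrow> contains w p"
  unfolding contains_iff_subseq using subseq_order.trans by blast

lemma order_iso_map:
  assumes "\<And>a b. a \<in> set v \<Longrightarrow> b \<in> set v \<Longrightarrow> f a \<le> f b \<longleftrightarrow> a \<le> b"
  shows "order_iso (map f v) p \<longleftrightarrow> order_iso v p"
  using assms unfolding order_iso_def by (auto simp: nth_mem)

lemma set_mono_subseq: "subseq v w \<Longrightarrow> set v \<subseteq> set w"
  by (induction rule: list_emb.induct) auto

lemma subseq_map_preimage:
  assumes "subseq v (map f w)"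
  shows "\<exists>v'. subseq v' w \<and> v = map f v'"
proof -
  from assms obtain N where "v = nths (map f w) N" by (auto simp: subseq_conv_nths)
  then have "v = map f (nths w N)" by (simp add: nths_map)
  then show ?thesis by (auto simp: subseq_conv_nths)
qed

lemma contains_map:
  assumes "\<And>a b. a \<in> set w \<Longrightarrow> b \<in> set w \<Longrightarrow> f a \<le> f b \<longleftrightarrow> a \<le> b"
  shows "contains (map f w) p \<longleftrightarrow> contains w p"
proof -
  have "order_iso (map f v) p \<longleftrightarrow> order_iso v p" if "subseq v w" for v
    using assms set_mono_subseq[OF that] by (intro order_iso_map) blast
  then show ?thesis
    unfolding contains_iff_subseq using subseq_map_preimage[of _ f w] subseq_map[of _ w f] by metis
qed

lemma contains_1212_iff: "contains w [1,2,1,2] \<longleftrightarrow> (\<exists>a b. a < b \<and> subseq [a,b,a,b] w)"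
proof
  assume "contains w [1,2,1,2]"
  then obtain v where v: "subseq v w" "order_iso v [1,2,1,2]" by (auto simp: contains_iff_subseq)
  then have "length v = 4" by (simp add: order_iso_def)
  then obtain a b c d where abcd: "v = [a,b,c,d]"
    by (auto simp: eval_nat_numeral length_Suc_conv)
  have *: "[a,b,c,d] ! i \<le> [a,b,c,d] ! j \<longleftrightarrow> [1,2,1,2::nat] ! i \<le> [1,2,1,2] ! j"
    if "i < 4" "j < 4" for i j
    using v(2) that abcd by (auto simp: order_iso_def)
  have "c = a" using *[of 0 2] *[of 2 0] by simp
  moreover have "d = b" using *[of 1 3] *[of 3 1] by (simp add: eval_nat_numeral)
  moreover have "a < b" using *[of 1 0] by simp
  ultimately show "\<exists>a b. a < b \<and> subseq [a,b,a,b] w" using v(1) abcd by blast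
next
  assume "\<exists>a b. a < b \<and> subseq [a,b,a,b] w"
  then obtain a b where ab: "a < b" "subseq [a,b,a,b] w" by blast
  have "order_iso [a,b,a,b] [1,2,1,2]"
    using ab(1) by (auto simp: order_iso_def less_Suc_eq eval_nat_numeral)
  with ab(2) show "contains w [1,2,1,2]" by (auto simp: contains_iff_subseq)
qed

text \<open>The shift in \<open>bracket\<close> lifts every letter of \<beta>, being at least 1,
  above all letters of \<alpha>. With the next lemma, occurrences of the bracket are occurrences of
  \<alpha> followed by occurrences of \<beta> in larger letters.\<close>

lemma order_iso_bracket:
  assumes "order_iso v1 \<alpha>" "order_iso v2 \<beta>" "\<And>x. x \<in> set \<beta> \<Longrightarrow> 1 \<le> x"
    and "\<And>x y. x \<in> set v1 \<Longrightarrow> y \<in> set v2 \<Longrightarrow> x < y"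
  shows "order_iso (v1 @ v2) (bracket \<alpha> \<beta>)"
proof -
  have max: "x \<le> nblocks \<alpha>" if "x \<in> set \<alpha>" for x
    using that by (simp add: nblocks_def)
  have len: "length v1 = length \<alpha>" "length v2 = length \<beta>"
    using assms by (auto simp: order_iso_def)
  have cross: "v1 ! i < v2 ! j" "\<alpha> ! i < \<beta> ! j + nblocks \<alpha>" if "i < length \<alpha>" "j < length \<beta>" for i j
    using assms(3)[of "\<beta> ! j"] assms(4)[of "v1 ! i" "v2 ! j"] max[of "\<alpha> ! i"] that len by auto
  show ?thesis
    unfolding order_iso_def bracket_def
  proof (intro conjI allI impI)
    fix a b
    assume ab: "a < length (\<alpha> @ map (\<lambda>x. x + nblocks \<alpha>) \<beta>)" "b < length (\<alpha> @ map (\<lambda>x. x + nblocks \<alpha>) \<beta>)"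
    show "((v1 @ v2) ! a \<le> (v1 @ v2) ! b) =
      ((\<alpha> @ map (\<lambda>x. x + nblocks \<alpha>) \<beta>) ! a \<le> (\<alpha> @ map (\<lambda>x. x + nblocks \<alpha>) \<beta>) ! b)"
    proof (cases "a < length \<alpha>"; cases "b < length \<alpha>")
      assume "a < length \<alpha>" "b < length \<alpha>"
      then show ?thesis using assms(1) by (simp add: nth_append len order_iso_def)
    next
      assume h: "a < length \<alpha>" "\<not> b < length \<alpha>"
      then have "b - length \<alpha> < length \<beta>" using ab by simp
      with h cross[of a "b - length \<alpha>"] ab show ?thesis by (simp add: nth_append len)
    next
      assume h: "\<not> a < length \<alpha>" "b < length \<alpha>"
      then have "a - length \<alpha> < length \<beta>" using ab by simp
      with h cross[of b "a - length \<alpha>"] ab show ?thesis by (simp add: nth_append len)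
    next
      assume h: "\<not> a < length \<alpha>" "\<not> b < length \<alpha>"
      then show ?thesis using assms(2) ab by (simp add: nth_append len order_iso_def)
    qed
  qed (simp add: len)
qed

lemma order_iso_bracketE:
  assumes "order_iso v (bracket \<alpha> \<beta>)" "\<And>x. x \<in> set \<beta> \<Longrightarrow> 1 \<le> x"
  obtains v1 v2 where "v = v1 @ v2" "order_iso v1 \<alpha>" "order_iso v2 \<beta>"
    "\<And>x y. x \<in> set v1 \<Longrightarrow> y \<in> set v2 \<Longrightarrow> x < y"
proof
  let ?n = "length \<alpha>" and ?r = "nblocks \<alpha>"
  have max: "x \<le> nblocks \<alpha>" if "x \<in> set \<alpha>" for x
    using that by (simp add: nblocks_def)
  have len: "length v = ?n + length \<beta>" using assms(1) by (simp add: order_iso_def bracket_def)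
  have iso: "v ! a \<le> v ! b \<longleftrightarrow> (\<alpha> @ map (\<lambda>x. x + ?r) \<beta>) ! a \<le> (\<alpha> @ map (\<lambda>x. x + ?r) \<beta>) ! b"
    if "a < ?n + length \<beta>" "b < ?n + length \<beta>" for a b
    using assms(1) that by (simp add: order_iso_def bracket_def)
  show "v = take ?n v @ drop ?n v" by simp
  show "order_iso (take ?n v) \<alpha>"
    using iso len by (auto simp: order_iso_def nth_append)
  show "order_iso (drop ?n v) \<beta>"
    unfolding order_iso_def
  proof (intro conjI allI impI)
    fix a b assume "a < length \<beta>" "b < length \<beta>"
    then show "(drop ?n v ! a \<le> drop ?n v ! b) = (\<beta> ! a \<le> \<beta> ! b)"
      using iso[of "?n + a" "?n + b"] len by (simp add: nth_append)
  qed (simp add: len)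
  fix x y assume "x \<in> set (take ?n v)" "y \<in> set (drop ?n v)"
  then obtain i j where ij: "i < ?n" "x = v ! i" "j < length \<beta>" "y = v ! (?n + j)"
    using len by (auto simp: in_set_conv_nth)
  have "\<alpha> ! i < \<beta> ! j + ?r"
    using assms(2)[of "\<beta> ! j"] max[of "\<alpha> ! i"] ij by force
  then show "x < y" using iso[of "?n + j" i] ij by (simp add: nth_append not_le[symmetric])
qed

section \<open>Restricted growth words\<close>

lemma nblocks_Nil [simp]: "nblocks [] = 0"
  by (simp add: nblocks_def)

lemma nblocks_append [simp]: "nblocks (v @ w) = max (nblocks v) (nblocks w)"
proof -
  have "Max (insert 0 (set v) \<union> insert 0 (set w)) = max (Max (insert 0 (set v))) (Max (insert 0 (set w)))"
    by (rule Max_Un) auto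
  then show ?thesis by (simp add: nblocks_def)
qed

lemma nblocks_singleton [simp]: "nblocks [x] = x"
  by (simp add: nblocks_def)

lemma le_nblocks: "x \<in> set w \<Longrightarrow> x \<le> nblocks w"
  by (simp add: nblocks_def)

lemma nblocks_le_iff: "nblocks w \<le> k \<longleftrightarrow> (\<forall>x\<in>set w. x \<le> k)"
  by (auto simp: nblocks_def)

lemma nblocks_map_add: "w \<noteq> [] \<Longrightarrow> nblocks (map (\<lambda>x. x + r) w) = nblocks w + r"
  by (induction w rule: rev_nonempty_induct) auto

lemma nblocks_bracket [simp]: "nblocks (bracket v w) = nblocks v + nblocks w"
  by (cases "w = []") (auto simp: bracket_def nblocks_map_add)

lemma bracket_Nil [simp]: "bracket [] w = w" "bracket v [] = v"
  by (simp_all add: bracket_def)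

lemma length_bracket [simp]: "length (bracket v w) = length v + length w"
  by (simp add: bracket_def)

lemma bracket_eq_Nil_iff [simp]: "bracket v w = [] \<longleftrightarrow> v = [] \<and> w = []"
  by (simp add: bracket_def)

lemma bracket_assoc: "bracket (bracket u v) w = bracket u (bracket v w)"
  by (simp add: bracket_def[of "bracket u v"] bracket_def[of v]) (simp add: bracket_def add_ac)

lemma is_partition_Nil [simp]: "is_partition []"
  by (simp add: is_partition_def)

lemma is_partition_snoc [simp]:
  "is_partition (w @ [x]) \<longleftrightarrow> is_partition w \<and> 1 \<le> x \<and> x \<le> nblocks w + 1"
  by (auto simp: is_partition_def less_Suc_eq nth_append)

lemma is_partition_appendD: "is_partition (v @ w) \<Longrightarrow> is_partition v"
proof (induction w rule: rev_induct)
  case (snoc x w)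
  then show ?case using is_partition_snoc[of "v @ w" x] by simp
qed simp

lemma is_partition_set: "is_partition w \<Longrightarrow> set w = {1..nblocks w}"
proof (induction w rule: rev_induct)
  case (snoc x w)
  then have x: "1 \<le> x" "x \<le> nblocks w + 1" and w: "set w = {1..nblocks w}" by auto
  show ?case
  proof (cases "x \<le> nblocks w")
    case True
    with x have "x \<in> {1..nblocks w}" by simp
    with True w show ?thesis by (simp add: insert_absorb max_absorb1)
  next
    case False
    with x have "x = Suc (nblocks w)" by simp
    with w show ?thesis by (simp add: atLeastAtMostSuc_conv max_absorb2)
  qed
qed simp

lemma is_partition_ge_1: "is_partition w \<Longrightarrow> x \<in> set w \<Longrightarrow> 1 \<le> x"
  by (simp add: is_partition_set)

lemma is_partition_bracket:
  assumes "is_partition v" "is_partition w"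
  shows "is_partition (bracket v w)"
  using assms(2)
proof (induction w rule: rev_induct)
  case Nil
  show ?case using assms(1) by simp
next
  case (snoc x w)
  have "bracket v (w @ [x]) = bracket v w @ [x + nblocks v]" by (simp add: bracket_def)
  with snoc show ?case by simp
qed

text \<open>The prefix ending in \<open>y\<close> is again a restricted growth word, so its letters
  fill an interval starting at 1. This supplies the first letter of the crossings built
  below.\<close>

lemma is_partition_earlier_letter:
  assumes "is_partition (p @ y # q)" "1 \<le> x" "x < y"
  shows "x \<in> set p"
proof -
  have "is_partition (p @ [y])" using assms(1) is_partition_appendD[of "p @ [y]" q] by simp
  then show ?thesis using assms by (auto simp: is_partition_set)
qed

lemma nblocks_le_length: "is_partition w \<Longrightarrow> nblocks w \<le> length w"
  by (metis card_atLeastAtMost card_length diff_Suc_1 is_partition_set)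

lemma noncrossing_iff:
  "noncrossing w \<longleftrightarrow> is_partition w \<and> (\<forall>a b. a < b \<longrightarrow> \<not> subseq [a,b,a,b] w)"
  unfolding noncrossing_def avoids_def contains_1212_iff by blast

lemma noncrossing_appendD: "noncrossing (v @ w) \<Longrightarrow> noncrossing v"
  unfolding noncrossing_iff using is_partition_appendD subseq_rev_drop_many by blast

lemma noncrossing_Nil [simp]: "noncrossing []"
  by (simp add: noncrossing_iff)

section \<open>Cutting a word before the first occurrence of a letter\<close>

definition low :: "nat \<Rightarrow> nat list \<Rightarrow> nat list" where
  "low x w = takeWhile (\<lambda>y. y \<le> x) w"

definition high :: "nat \<Rightarrow> nat list \<Rightarrow> nat list" where
  "high x w = map (\<lambda>y. y - x) (filter (\<lambda>y. x < y) w)"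

lemma high_Nil [simp]: "high x [] = []"
  by (simp add: high_def)

lemma high_append: "high x (v @ w) = high x v @ high x w"
  by (simp add: high_def)

lemma nblocks_high [simp]: "nblocks (high x w) = nblocks w - x"
  by (induction w rule: rev_induct) (auto simp: high_def max_def)

lemma high_snoc: "high x (w @ [y]) = (if x < y then high x w @ [y - x] else high x w)"
  by (simp add: high_def)

lemma is_partition_high: "is_partition w \<Longrightarrow> is_partition (high x w)"
  by (induction w rule: rev_induct) (auto simp: high_snoc)

lemma contains_high: "contains (high x w) p \<longleftrightarrow> contains (filter (\<lambda>y. x < y) w) p"
  unfolding high_def by (rule contains_map) auto

lemma noncrossing_high: "noncrossing w \<Longrightarrow> noncrossing (high x w)"
  unfolding noncrossing_def avoids_def
  using contains_high contains_subseq is_partition_high subseq_filter_left by blast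

lemma low_0: "is_partition w \<Longrightarrow> low 0 w = []"
  by (cases w) (auto simp: low_def dest: is_partition_ge_1)

lemma high_0: "is_partition w \<Longrightarrow> high 0 w = w"
  by (simp add: high_def is_partition_set)

lemma low_nblocks: "nblocks w \<le> x \<Longrightarrow> low x w = w"
  by (auto simp: low_def takeWhile_eq_all_conv nblocks_le_iff)

lemma high_nblocks: "nblocks w \<le> x \<Longrightarrow> high x w = []"
  by (auto simp: high_def filter_empty_conv nblocks_le_iff)

text \<open>A positive \<open>x\<close> precedes any letter above it, so the cut prefix has already
  reached \<open>x\<close>. Thus \<open>x\<close> can be read off from \<open>low x w\<close>, which
  later keeps different cuts apart.\<close>

lemma nblocks_low:
  assumes "is_partition w" "x \<le> nblocks w"
  shows "nblocks (low x w) = x"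
proof (rule antisym)
  show "nblocks (low x w) \<le> x" by (auto simp: low_def nblocks_le_iff dest: set_takeWhileD)
  show "x \<le> nblocks (low x w)"
  proof (cases "dropWhile (\<lambda>y. y \<le> x) w")
    case Nil
    then have "low x w = w" by (simp add: low_def takeWhile_eq_all_conv dropWhile_eq_Nil_conv)
    with assms show ?thesis by simp
  next
    case (Cons y q)
    then have w: "w = low x w @ y # q" and "x < y"
      unfolding low_def by (metis takeWhile_dropWhile_id, metis dropWhile_eq_Cons_conv not_le)
    then have "x = 0 \<or> x \<in> set (low x w)"
      using is_partition_earlier_letter[of "low x w" y q x] assms(1) by fastforce
    then show ?thesis using le_nblocks by auto
  qed
qed

lemma subseq_low_mono: "x \<le> y \<Longrightarrow> subseq (low x w) (low y w)"
  unfolding low_def by (induction w) auto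

lemma contains_high_mono:
  assumes "x \<le> y" "contains (high y w) p"
  shows "contains (high x w) p"
proof -
  have "filter (\<lambda>z. y < z) w = filter (\<lambda>z. y < z) (filter (\<lambda>z. x < z) w)"
    using assms(1) by (auto intro: filter_cong)
  then have "subseq (filter (\<lambda>z. y < z) w) (filter (\<lambda>z. x < z) w)"
    by (metis subseq_filter_left)
  with assms(2) show ?thesis using contains_subseq by (auto simp: contains_high)
qed

text \<open>This and the next three lemmas follow a cut through a bracket. The letter
  \<open>nblocks v\<close> occurs in \<open>v\<close> and stops every smaller cut there; from
  \<open>nblocks v\<close> on, the cut falls in the shifted copy of \<open>w\<close>.\<close>

lemma low_bracket_less:
  assumes "is_partition v" "is_partition w" "x < nblocks v"
  shows "low x (bracket v w) = low x v"
proof -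
  have "nblocks v \<in> set v" using assms by (auto simp: is_partition_set)
  with assms(3) show ?thesis by (force simp: low_def bracket_def takeWhile_append)
qed

lemma low_bracket_ge:
  assumes "nblocks v \<le> x"
  shows "low x (bracket v w) = bracket v (low (x - nblocks v) w)"
  using assms by (auto simp: low_def bracket_def takeWhile_append takeWhile_map comp_def
      nblocks_le_iff le_diff_conv2 dest: le_nblocks intro!: arg_cong[where f = "map _"] takeWhile_cong)

lemma high_bracket_le:
  assumes "is_partition w" "x \<le> nblocks v"
  shows "high x (bracket v w) = bracket (high x v) w"
proof -
  have "filter (\<lambda>y. x < y + nblocks v) w = w"
    using assms by (force intro!: filter_True dest: is_partition_ge_1)
  with assms(2) show ?thesis
    by (simp add: bracket_def high_append) (simp add: high_def filter_map comp_def)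
qed

lemma high_bracket_ge:
  assumes "nblocks v \<le> x"
  shows "high x (bracket v w) = high (x - nblocks v) w"
  using assms high_nblocks[of v x] by (simp add: bracket_def high_append)
    (auto simp: high_def filter_map comp_def less_diff_conv2 intro!: map_cong filter_cong)

text \<open>For \<open>1 \<le> x < nblocks w\<close> the closing 1 of a tree comes after a letter
  above \<open>x\<close> and is not itself above \<open>x\<close>, so neither side of the cut sees
  it.\<close>

lemma low_snoc_1: "x < nblocks w \<Longrightarrow> low x (w @ [1]) = low x w"
  by (auto simp: low_def takeWhile_append nblocks_le_iff simp flip: not_le)

lemma high_snoc_1: "1 \<le> x \<Longrightarrow> high x (w @ [1]) = high x w"
  by (simp add: high_def)

text \<open>An occurrence of \<open>bracket \<alpha> \<beta>\<close> is cut at the smallest letter \<open>y\<close> that it uses for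
  \<open>\<beta>\<close>: a letter \<open>a < y\<close> of the occurrence of \<open>\<alpha>\<close> placed after the first \<open>y\<close> would give the
  crossing \<open>a y a y\<close>.\<close>

lemma contains_bracket_iff:
  assumes "noncrossing w" "is_partition \<beta>"
  shows "contains w (bracket \<alpha> \<beta>) \<longleftrightarrow>
    (\<exists>x \<le> nblocks w. contains (low x w) \<alpha> \<and> contains (high x w) \<beta>)"
proof
  have part: "is_partition w" using assms(1) by (simp add: noncrossing_def)
  assume c: "contains w (bracket \<alpha> \<beta>)"
  show "\<exists>x \<le> nblocks w. contains (low x w) \<alpha> \<and> contains (high x w) \<beta>"
  proof (cases "\<beta> = []")
    case True
    with c show ?thesis by (intro exI[of _ "nblocks w"]) (simp add: low_nblocks)
  next
    case False
    from c obtain v where v: "subseq v w" "order_iso v (bracket \<alpha> \<beta>)"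
      by (auto simp: contains_iff_subseq)
    obtain v1 v2 where
      vv: "v = v1 @ v2" "order_iso v1 \<alpha>" "order_iso v2 \<beta>"
        "\<And>x y. x \<in> set v1 \<Longrightarrow> y \<in> set v2 \<Longrightarrow> x < y"
      using order_iso_bracketE[OF v(2) is_partition_ge_1[OF assms(2)]] by metis
    from v(1) vv(1) obtain w1 w2 where w: "w = w1 @ w2" "subseq v1 w1" "subseq v2 w2"
      using list_emb_appendD[of "(=)" v1 v2 w] by auto
    have "v2 \<noteq> []" using vv(3) False by (auto simp: order_iso_def)
    define y where "y = Min (set v2)"
    have y: "y \<in> set v2" "\<And>z. z \<in> set v2 \<Longrightarrow> y \<le> z"
      using \<open>v2 \<noteq> []\<close> by (auto simp: y_def)
    have yw2: "y \<in> set w2" using y(1) set_mono_subseq[OF w(3)] by blast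
    then have "y \<in> set w" using w(1) by simp
    then have "1 \<le> y" "y \<le> nblocks w" using is_partition_set[OF part] by simp_all
    have "subseq v2 (filter (\<lambda>z. y - 1 < z) w)"
    proof -
      have "filter (\<lambda>z. y - 1 < z) v2 = v2"
        using y(2) \<open>1 \<le> y\<close> by (force intro!: filter_True)
      moreover have "subseq v2 w" using w by auto
      ultimately show ?thesis by (metis subseq_filter)
    qed
    then have "contains (high (y - 1) w) \<beta>"
      using vv(3) unfolding contains_high unfolding contains_iff_subseq by blast
    moreover have "subseq v1 (low (y - 1) w)"
    proof (cases "\<exists>z\<in>set w1. y - 1 < z")
      case False
      then have "low (y - 1) w = w1 @ low (y - 1) w2"
        by (auto simp: low_def w(1) takeWhile_append not_less)
      then show ?thesis using w(2) by (simp add: subseq_rev_drop_many)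
    next
      case True
      have pw1: "is_partition w1" using part w(1) is_partition_appendD by blast
      obtain p z q where w1: "w1 = p @ z # q" and z: "\<not> z \<le> y - 1" and p: "p = low (y - 1) w1"
      proof -
        have "dropWhile (\<lambda>z. z \<le> y - 1) w1 \<noteq> []" using True by (simp add: dropWhile_eq_Nil_conv not_le)
        then obtain z q where "dropWhile (\<lambda>z. z \<le> y - 1) w1 = z # q" by (meson neq_Nil_conv)
        then show ?thesis
          using that[of "low (y - 1) w1" z q] takeWhile_dropWhile_id[of "\<lambda>z. z \<le> y - 1" w1]
          by (simp add: low_def dropWhile_eq_Cons_conv)
      qed
      have pl: "p = low (y - 1) w"
        using True takeWhile_append1[of _ w1 "\<lambda>z. z \<le> y - 1" w2]
        unfolding p low_def w(1) by (metis not_le)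
      \<comment> \<open>By restricted growth \<open>y\<close> precedes any larger letter, but
        \<open>p\<close> only has letters below \<open>y\<close>.\<close>
      have "z = y"
      proof (rule ccontr)
        assume "z \<noteq> y"
        then have "y \<in> set p" using is_partition_earlier_letter[of p z q y] pw1 w1 z \<open>1 \<le> y\<close> by simp
        then show False using \<open>1 \<le> y\<close> by (auto simp: p low_def dest: set_takeWhileD)
      qed
      have disj: "a \<notin> set (z # q)" if "a \<in> set v1" for a
      proof
        assume "a \<in> set (z # q)"
        moreover have "a < y" using vv(4) that y(1) by blast
        ultimately have aq: "a \<in> set q" using \<open>z = y\<close> by auto
        then have "1 \<le> a" using pw1 w1 is_partition_ge_1 by auto
        then have ap: "a \<in> set p"
          using is_partition_earlier_letter[of p y q a] pw1 w1 \<open>z = y\<close> \<open>a < y\<close> by simp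
        have "subseq ([a] @ [y] @ [a] @ [y]) (p @ [y] @ q @ w2)"
          using ap aq yw2 by (intro list_emb_append_mono) (auto simp: subseq_singleton_left)
        then have "subseq [a,y,a,y] w" using w(1) w1 \<open>z = y\<close> by simp
        with assms(1) \<open>a < y\<close> show False by (auto simp: noncrossing_iff)
      qed
      \<comment> \<open>The part of \<open>v1\<close> behind the cut is a subsequence of
        \<open>z # q\<close> but shares no letter with it, hence is empty.\<close>
      from w(2) w1 obtain a b where ab: "v1 = a @ b" "subseq a p" "subseq b (z # q)"
        by (auto elim: subseq_appendE)
      then have "set b \<inter> set (z # q) = {}" using disj by auto
      with set_mono_subseq[OF ab(3)] have "b = []" by (cases b) auto
      then show ?thesis using ab pl by simp
    qed
    then have "contains (low (y - 1) w) \<alpha>" using vv(2) by (auto simp: contains_iff_subseq)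
    ultimately show ?thesis using \<open>y \<le> nblocks w\<close> by (intro exI[of _ "y - 1"]) auto
  qed
next
  assume "\<exists>x \<le> nblocks w. contains (low x w) \<alpha> \<and> contains (high x w) \<beta>"
  then obtain x v1 v2 where v: "subseq v1 (low x w)" "order_iso v1 \<alpha>"
    "subseq v2 (filter (\<lambda>y. x < y) w)" "order_iso v2 \<beta>"
    unfolding contains_high unfolding contains_iff_subseq by blast
  \<comment> \<open>All letters above \<open>x\<close> come after the cut prefix, so the two
    occurrences can be concatenated.\<close>
  have "filter (\<lambda>y. x < y) w = filter (\<lambda>y. x < y) (dropWhile (\<lambda>y. y \<le> x) w)"
    by (induction w) auto
  then have "subseq v2 (dropWhile (\<lambda>y. y \<le> x) w)"
    using v(3) subseq_filter_left subseq_order.trans by metis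
  then have "subseq (v1 @ v2) w"
    using v(1) list_emb_append_mono[of "(=)" v1 "low x w" v2] by (metis low_def takeWhile_dropWhile_id)
  moreover have "order_iso (v1 @ v2) (bracket \<alpha> \<beta>)"
  proof (rule order_iso_bracket[OF v(2,4)])
    show "1 \<le> x" if "x \<in> set \<beta>" for x using assms(2) that is_partition_ge_1 by blast
    fix a b assume "a \<in> set v1" "b \<in> set v2"
    then have "a \<in> set (low x w)" "b \<in> set (filter (\<lambda>y. x < y) w)"
      using set_mono_subseq[OF v(1)] set_mono_subseq[OF v(3)] by blast+
    then show "a < b" by (auto simp: low_def dest: set_takeWhileD)
  qed
  ultimately show "contains w (bracket \<alpha> \<beta>)" by (auto simp: contains_iff_subseq)
qed

section \<open>Non-crossing partitions as ordered forests\<close>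

datatype tree = Node "tree list"

text \<open>In postorder, every node contributes one letter; the leaves open the blocks, and the
  letter of an inner node repeats the letter of its leftmost leaf.\<close>

fun word :: "tree list \<Rightarrow> nat list" where
  "word [] = []"
| "word (Node cs # ts) = bracket (word cs @ [1]) (word ts)"

fun nodes :: "tree list \<Rightarrow> nat" where
  "nodes [] = 0"
| "nodes (Node cs # ts) = Suc (nodes cs + nodes ts)"

lemma word_append: "word (F @ G) = bracket (word F) (word G)"
proof (induction F)
  case (Cons t F)
  then show ?case by (cases t) (simp add: bracket_assoc)
qed simp

lemma nodes_append [simp]: "nodes (F @ G) = nodes F + nodes G"
proof (induction F)
  case (Cons t F)
  then show ?case by (cases t) simp
qed simp

lemma length_word [simp]: "length (word F) = nodes F"
  by (induction F rule: word.induct) simp_all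

lemma nodes_eq_0_iff [simp]: "nodes F = 0 \<longleftrightarrow> F = []"
  by (induction F rule: nodes.induct) simp_all

lemma word_eq_Nil_iff [simp]: "word F = [] \<longleftrightarrow> F = []"
  by (metis length_0_conv length_word nodes_eq_0_iff)

text \<open>The two parts use disjoint letters, and in \<open>a b a b\<close> neither letter has all
  its occurrences before those of the other. So a crossing lies within one part.\<close>

lemma noncrossing_bracket:
  assumes "noncrossing v" "noncrossing w"
  shows "noncrossing (bracket v w)"
  unfolding noncrossing_iff
proof (intro conjI allI impI notI)
  let ?r = "nblocks v" and ?w = "map (\<lambda>x. x + nblocks v) w"
  have pv: "is_partition v" and pw: "is_partition w" using assms by (auto simp: noncrossing_def)
  show "is_partition (bracket v w)" using pv pw by (rule is_partition_bracket)
  have w_large: "x > ?r" if "x \<in> set ?w" for x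
    using that is_partition_ge_1[OF pw] by fastforce
  have v_small: "x \<le> ?r" if "x \<in> set v" for x
    using that by (rule le_nblocks)
  fix a b assume "a < b" and "subseq [a,b,a,b] (bracket v w)"
  then obtain xs ys where xy: "[a,b,a,b] = xs @ ys" "subseq xs v" "subseq ys ?w"
    unfolding bracket_def using list_emb_appendD subseq_append_iff by metis
  have xs: "x \<le> ?r" if "x \<in> set xs" for x using that v_small set_mono_subseq[OF xy(2)] by blast
  have ys: "x > ?r" if "x \<in> set ys" for x using that w_large set_mono_subseq[OF xy(3)] by blast
  show False
  proof (cases xs)
    case Nil
    with xy have "subseq [a,b,a,b] ?w" by simp
    then obtain u where "subseq u w" "[a,b,a,b] = map (\<lambda>x. x + ?r) u"
      using subseq_map_preimage by metis
    then obtain a' b' where "u = [a',b',a',b']" "a' < b'" using \<open>a < b\<close> by auto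
    with \<open>subseq u w\<close> assms(2) show False by (auto simp: noncrossing_iff)
  next
    case (Cons x xs')
    then have "a \<le> ?r" using xy(1) xs[of a] by simp
    then have "a \<notin> set ys" using ys by force
    \<comment> \<open>Every suffix of \<open>[a,b,a,b]\<close> with at least two letters contains
      \<open>a\<close>.\<close>
    then have "length ys \<le> 1"
      using xy(1) Cons by (cases xs'; cases "tl xs'"; cases "tl (tl xs')"; auto)
    show False
    proof (cases ys)
      case Nil
      with xy \<open>a < b\<close> assms(1) show False by (auto simp: noncrossing_iff)
    next
      case (Cons y ys')
      with \<open>length ys \<le> 1\<close> have "ys = [y]" by simp
      with xy(1) have "y = b" "xs = [a,b,a]" by (auto simp: append_eq_Cons_conv Cons_eq_append_conv)
      with xs[of b] ys[of b] \<open>ys = [y]\<close> show False by simp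
    qed
  qed
qed

text \<open>A crossing using the added 1 would have it as its last letter \<open>b\<close>, leaving
  \<open>a = 0\<close>, which is not a letter.\<close>

lemma noncrossing_snoc_1:
  assumes "noncrossing v"
  shows "noncrossing (v @ [1])"
  unfolding noncrossing_iff
proof (intro conjI allI impI notI)
  have pv: "is_partition v" using assms by (auto simp: noncrossing_def)
  then show "is_partition (v @ [1])" by simp
  fix a b :: nat assume "a < b" and "subseq [a,b,a,b] (v @ [1])"
  then obtain xs ys where xy: "[a,b,a,b] = xs @ ys" "subseq xs v" "subseq ys [1]"
    using subseq_append_iff by metis
  show False
  proof (cases ys rule: rev_cases)
    case Nil
    with xy \<open>a < b\<close> assms show False by (auto simp: noncrossing_iff)
  next
    case (snoc ys' y)
    with xy(1) have "y = b" "[a,b,a] = xs @ ys'"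
      using butlast_append[of xs ys] by (auto simp: append_eq_Cons_conv Cons_eq_append_conv)
    moreover have "length ys \<le> 1" using list_emb_length[OF xy(3)] by simp
    ultimately have "xs = [a,b,a]" "b = 1" using snoc set_mono_subseq[OF xy(3)] by auto
    then have "0 \<in> set v" using \<open>a < b\<close> set_mono_subseq[OF xy(2)] by auto
    with is_partition_ge_1[OF pv] show False by fastforce
  qed
qed

lemma noncrossing_word: "noncrossing (word F)"
  by (induction F rule: word.induct) (auto intro: noncrossing_bracket noncrossing_snoc_1 simp del: One_nat_def)

lemma is_partition_word [simp]: "is_partition (word F)"
  using noncrossing_word by (simp add: noncrossing_def)

lemma noncrossing_bracketD:
  assumes "noncrossing (bracket v w)" "is_partition w"
  shows "noncrossing v" "noncrossing w"
proof -
  show "noncrossing v" using assms(1) unfolding bracket_def by (rule noncrossing_appendD)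
  have "high (nblocks v) (bracket v w) = w"
    using high_bracket_ge[of v "nblocks v" w] high_0[OF assms(2)] by simp
  with noncrossing_high[OF assms(1)] show "noncrossing w" by metis
qed

text \<open>The word is cut before the first occurrence of its last letter \<open>k\<close>. A
  smaller letter \<open>a\<close> behind that place would also stand before it and form the crossing
  \<open>a k a k\<close> with the final \<open>k\<close>.\<close>

lemma noncrossing_last_1_or_bracket:
  assumes "noncrossing w" "w \<noteq> []" "last w \<noteq> 1"
  obtains v u where "w = bracket v u" "v \<noteq> []" "u \<noteq> []" "noncrossing v" "noncrossing u"
proof -
  have pw: "is_partition w" using assms(1) by (simp add: noncrossing_def)
  define k where "k = last w"
  have "k \<in> set w" using assms(2) by (simp add: k_def)
  then have "k > 1" using is_partition_ge_1[OF pw] assms(3) by (force simp: k_def)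
  obtain p q where w: "w = p @ k # q" "k \<notin> set p" using \<open>k \<in> set w\<close> split_list_first by metis
  have "is_partition (p @ [k])" using pw w(1) is_partition_appendD[of "p @ [k]" q] by simp
  then have pp: "is_partition p" and "k \<le> nblocks p + 1" by auto
  moreover have "\<not> k \<le> nblocks p" using w(2) is_partition_set[OF pp] \<open>k > 1\<close> by simp
  ultimately have k: "nblocks p = k - 1" by simp
  have q: "k \<le> a" if "a \<in> set q" for a
  proof (rule ccontr)
    assume "\<not> k \<le> a"
    then have "a < k" by simp
    have "1 \<le> a" using is_partition_ge_1[OF pw] that w(1) by simp
    then have "a \<in> set p" using is_partition_earlier_letter[of p k q a] pw w(1) \<open>a < k\<close> by simp
    have "q \<noteq> []" using that by auto
    moreover have "last q = k" using \<open>q \<noteq> []\<close> k_def by (simp add: w(1))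
    ultimately obtain q' where q': "q = q' @ [k]" by (metis append_butlast_last_id)
    then have "a \<in> set q'" using that \<open>a < k\<close> by auto
    have "subseq ([a] @ [k] @ [a] @ [k]) (p @ [k] @ q' @ [k])"
      using \<open>a \<in> set p\<close> \<open>a \<in> set q'\<close> by (intro list_emb_append_mono) (auto simp: subseq_singleton_left)
    then show False using assms(1) \<open>a < k\<close> w(1) q' by (auto simp: noncrossing_iff)
  qed
  have "bracket p (high (k - 1) w) = w"
  proof -
    have "high (k - 1) p = []" using high_nblocks[of p "k - 1"] k by simp
    moreover have "filter (\<lambda>y. k - 1 < y) (k # q) = k # q"
      using q \<open>k > 1\<close> by (intro filter_True) force
    moreover have "map (\<lambda>x. x + (k - 1)) (map (\<lambda>y. y - (k - 1)) (k # q)) = k # q"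
      using q \<open>k > 1\<close> by (auto intro!: map_idI simp: comp_def) force
    ultimately show ?thesis
      unfolding bracket_def k by (simp add: w(1) high_append del: map_map) (simp add: high_def)
  qed
  moreover have "p \<noteq> []" using k \<open>k > 1\<close> by auto
  moreover have "high (k - 1) w \<noteq> []" using w(1) \<open>k > 1\<close> by (simp add: high_def)
  moreover have "noncrossing p" using assms(1) w(1) noncrossing_appendD by blast
  ultimately show ?thesis using that noncrossing_high[OF assms(1)] by metis
qed

text \<open>Induction on the length: a final 1 is the root of a single tree and is stripped off, and
  any other last letter lets the word split into two shorter factors.\<close>

lemma noncrossing_imp_word:
  assumes "noncrossing w"
  shows "\<exists>F. word F = w"
  using assms
proof (induction w rule: length_induct)
  case (1 w)
  show ?case
  proof (cases "w = []")
    case True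
    then show ?thesis by (intro exI[of _ "[]"]) simp
  next
    case False
    show ?thesis
    proof (cases "last w = 1")
      case True
      then have w: "w = butlast w @ [1]" using False by (metis append_butlast_last_id)
      then have "noncrossing (butlast w)" using 1(2) noncrossing_appendD by metis
      then obtain F where "word F = butlast w" using 1(1) False by fastforce
      then have "word [Node F] = w" using w by simp
      then show ?thesis by blast
    next
      case last: False
      obtain v u where vu: "w = bracket v u" "v \<noteq> []" "u \<noteq> []" "noncrossing v" "noncrossing u"
        using noncrossing_last_1_or_bracket[OF 1(2) False last] .
      then have "length v < length w" "length u < length w" by auto
      then obtain F G where "word F = v" "word G = u" using 1(1) vu by blast
      then have "word (F @ G) = w" using vu(1) by (simp add: word_append)
      then show ?thesis by blast
    qed
  qed
qed

section \<open>Uniqueness of the forest of a word\<close>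

lemma append_Cons_last_eq:
  assumes "ys @ x # zs = ys' @ x # zs'" "x \<notin> set zs" "x \<notin> set zs'"
  shows "ys = ys' \<and> zs = zs'"
  using assms by (auto simp: append_eq_append_conv2 Cons_eq_append_conv append_eq_Cons_conv)

text \<open>The root of the first tree is the last 1 of the word, since the words of the later trees
  are shifted by at least 1. Splitting there recovers the children and the remaining trees.\<close>

lemma word_inject: "word F = word G \<Longrightarrow> F = G"
proof (induction F arbitrary: G rule: word.induct)
  case 1
  then show ?case by (metis word_eq_Nil_iff)
next
  case (2 cs ts)
  have "G \<noteq> []" using 2(3) by (metis list.distinct(1) word_eq_Nil_iff)
  then obtain cs' ts' where G: "G = Node cs' # ts'" by (metis neq_Nil_conv tree.exhaust)
  define k k' where "k = nblocks (word cs @ [1])" and "k' = nblocks (word cs' @ [1])"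
  have "k \<ge> 1" "k' \<ge> 1" by (auto simp: k_def k'_def)
  have eq: "word cs @ 1 # map (\<lambda>x. x + k) (word ts) = word cs' @ 1 # map (\<lambda>x. x + k') (word ts')"
    using 2(3) G by (simp add: bracket_def k_def k'_def)
  moreover have "1 \<notin> set (map (\<lambda>x. x + k) (word ts))" "1 \<notin> set (map (\<lambda>x. x + k') (word ts'))"
    using \<open>k \<ge> 1\<close> \<open>k' \<ge> 1\<close> is_partition_ge_1[OF is_partition_word] by fastforce+
  ultimately have "word cs = word cs'" and tails: "map (\<lambda>x. x + k) (word ts) = map (\<lambda>x. x + k') (word ts')"
    using append_Cons_last_eq by metis+
  then have "cs = cs'" using 2(1) by blast
  then have "map (\<lambda>x. x + k) (word ts) = map (\<lambda>x. x + k) (word ts')"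
    using tails by (simp add: k_def k'_def)
  then have "word ts = word ts'" by (simp add: inj_map_eq_map)
  then have "ts = ts'" using 2(2) by blast
  with \<open>cs = cs'\<close> G show ?case by simp
qed

lemma inj_word: "inj word"
  using word_inject by (rule injI)

lemma word_eq_iff [simp]: "word F = word G \<longleftrightarrow> F = G"
  using word_inject by blast

section \<open>Components correspond to trees\<close>

lemma iter_bracket_Nil [simp]: "iter_bracket [] = []"
  by (simp add: iter_bracket_def)

lemma iter_bracket_append [simp]:
  "iter_bracket (xs @ ys) = bracket (iter_bracket xs) (iter_bracket ys)"
proof (induction ys rule: rev_induct)
  case (snoc y ys)
  have "iter_bracket (zs @ [y]) = bracket (iter_bracket zs) y" for zs
    by (simp add: iter_bracket_def)
  from this[of "xs @ ys"] this[of ys] snoc show ?case by (simp add: bracket_assoc)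
qed simp

lemma iter_bracket_Cons [simp]: "iter_bracket (x # xs) = bracket x (iter_bracket xs)"
  using iter_bracket_append[of "[x]" xs] by (simp add: iter_bracket_def)

lemma is_partition_iter_bracket: "\<forall>c\<in>set cs. is_partition c \<Longrightarrow> is_partition (iter_bracket cs)"
  by (induction cs) (auto intro: is_partition_bracket)

lemma noncrossing_iter_bracketD:
  assumes "noncrossing (iter_bracket cs)" "\<forall>c\<in>set cs. is_partition c" "c \<in> set cs"
  shows "noncrossing c"
  using assms
proof (induction cs)
  case (Cons d cs)
  then have "noncrossing d" "noncrossing (iter_bracket cs)"
    using noncrossing_bracketD[of d "iter_bracket cs"] is_partition_iter_bracket[of cs] by auto
  with Cons show ?case by auto
qed simp

text \<open>The word of a tree ends in the 1 of its root, whereas a bracket of nonempty partitions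
  ends in a letter above 1.\<close>

lemma connected_word_tree: "connected (word [t])"
  unfolding connected_def
proof (intro notI, elim exE conjE)
  fix a b assume ab: "is_partition a" "is_partition b" "a \<noteq> []" "b \<noteq> []" "word [t] = bracket a b"
  have "last (word [t]) = 1" by (cases t) simp
  moreover have "last (bracket a b) = last b + nblocks a"
    using ab(4) by (simp add: bracket_def last_map)
  moreover have "1 \<le> last b" using is_partition_ge_1[OF ab(2)] ab(4) by simp
  ultimately have "nblocks a = 0" using ab(5) by simp
  then show False using is_partition_set[OF ab(1)] ab(3) by simp
qed

lemma iter_bracket_trees: "iter_bracket (map (\<lambda>t. word [t]) F) = word F"
proof (induction F)
  case (Cons t F)
  then show ?case using word_append[of "[t]" F] by simp
qed simp

text \<open>For uniqueness under \<open>THE\<close>: a factor of a non-crossing word is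
  non-crossing, hence the word of a forest, and connectedness leaves that forest a single tree.
  Injectivity of \<open>word\<close> does the rest.\<close>

lemma components_word: "components (word F) = map (\<lambda>t. word [t]) F"
  unfolding components_def
proof (rule the_equality)
  show "(\<forall>c\<in>set (map (\<lambda>t. word [t]) F). is_partition c \<and> c \<noteq> [] \<and> connected c) \<and>
    iter_bracket (map (\<lambda>t. word [t]) F) = word F"
    by (auto simp: iter_bracket_trees connected_word_tree simp del: word.simps)
next
  fix cs assume cs: "(\<forall>c\<in>set cs. is_partition c \<and> c \<noteq> [] \<and> connected c) \<and> iter_bracket cs = word F"
  have "\<exists>t. c = word [t]" if c: "c \<in> set cs" for c
  proof -
    have "noncrossing c" using noncrossing_iter_bracketD[of cs c] cs c noncrossing_word[of F] by simp
    then obtain G where G: "word G = c" using noncrossing_imp_word by blast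
    with cs c obtain t G' where G': "G = t # G'" by (cases G) auto
    have "c = bracket (word [t]) (word G')" using G G' word_append[of "[t]" G'] by simp
    moreover have "connected c" using cs c by blast
    ultimately have "word G' = []"
      unfolding connected_def by (metis is_partition_word list.distinct(1) word_eq_Nil_iff)
    with G G' show ?thesis by auto
  qed
  then obtain F' where F': "cs = map (\<lambda>t. word [t]) F'"
    using ex_map_conv[of cs "\<lambda>t. word [t]"] by blast
  then have "word F' = word F" using cs by (simp add: iter_bracket_trees del: word_eq_iff)
  with F' show "cs = map (\<lambda>t. word [t]) F" by simp
qed

lemma ncomponents_word: "ncomponents (word F) = length F"
  by (simp add: ncomponents_def components_word)

text \<open>\<open>word\<close> embeds these forests into the words of length \<open>n\<close> over
  a finite alphabet. Finiteness later turns equal cardinalities into bijections.\<close>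

lemma finite_forests: "finite {F. nodes F = n}"
proof (rule finite_imageD)
  have "word ` {F. nodes F = n} \<subseteq> {w. set w \<subseteq> {..n} \<and> length w = n}"
  proof clarify
    fix F assume "n = nodes F"
    then show "set (word F) \<subseteq> {..nodes F} \<and> length (word F) = nodes F"
      using nblocks_le_length[of "word F"] le_nblocks[of _ "word F"] by fastforce
  qed
  then show "finite (word ` {F. nodes F = n})"
    using finite_lists_length_eq[of "{..n}" n] finite_subset by blast
  show "inj_on word {F. nodes F = n}" using inj_word inj_on_subset by blast
qed

section \<open>Cutting a forest\<close>

text \<open>A triple \<open>(s, u, r)\<close> describes a forest together with a place in it. The pairs in \<open>s\<close>
  give, from the root downwards, the numbers of left and right siblings of the nodes on the path to
  that place; \<open>u\<close> and \<open>r\<close> are the forests of all trees hanging to the left and to the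
  right of the path.\<close>

fun plug :: "(nat \<times> nat) list \<Rightarrow> tree list \<Rightarrow> tree list \<Rightarrow> tree list" where
  "plug [] u r = u @ r"
| "plug ((d, b) # s) u r =
    take d u @ Node (plug s (drop d u) (take (length r - b) r)) # drop (length r - b) r"

definition lefts :: "(nat \<times> nat) list \<Rightarrow> nat" where
  "lefts s = sum_list (map fst s)"

definition rights :: "(nat \<times> nat) list \<Rightarrow> nat" where
  "rights s = sum_list (map snd s)"

lemma lefts_simps [simp]: "lefts [] = 0" "lefts (x # s) = fst x + lefts s"
  by (simp_all add: lefts_def)

lemma rights_simps [simp]: "rights [] = 0" "rights (x # s) = snd x + rights s"
  by (simp_all add: rights_def)

text \<open>The place is either a gap at the top level, a gap between two siblings, or a leaf.\<close>

definition gap_path :: "(nat \<times> nat) list \<Rightarrow> nat \<Rightarrow> nat \<Rightarrow> bool" where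
  "gap_path s i j \<longleftrightarrow> s = [] \<or> lefts s < i \<and> rights s < j"

text \<open>Equality makes every tree of \<open>u\<close> and \<open>r\<close> a sibling of some
  path node, so the last node has no children. The strict bounds in \<open>gap_path\<close> instead
  leave a tree on either side of the gap below the last node.\<close>

definition leaf_path :: "(nat \<times> nat) list \<Rightarrow> nat \<Rightarrow> nat \<Rightarrow> bool" where
  "leaf_path s i j \<longleftrightarrow> s \<noteq> [] \<and> lefts s = i \<and> rights s = j"

text \<open>\<open>push\<close> updates a place when a tree is put in front of the forest,
  \<open>under\<close> when the forest becomes the children of a first root followed by
  \<open>ts\<close>.\<close>

fun push :: "tree \<Rightarrow> (nat \<times> nat) list \<times> tree list \<times> tree list \<Rightarrow>
    (nat \<times> nat) list \<times> tree list \<times> tree list" where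
  "push t ([], u, r) = ([], t # u, r)"
| "push t ((d, b) # s, u, r) = ((Suc d, b) # s, t # u, r)"

fun under :: "tree list \<Rightarrow> (nat \<times> nat) list \<times> tree list \<times> tree list \<Rightarrow>
    (nat \<times> nat) list \<times> tree list \<times> tree list" where
  "under ts (s, u, r) = ((0, length ts) # s, u, r @ ts)"

text \<open>The order matters: counting from 0, entry \<open>x\<close> is the cut before the first
  letter above \<open>x\<close>. Below the first root, places with an empty side are dropped, as the
  extreme cut letters of that tree are represented by the gaps before and after it.\<close>

fun gaps :: "tree list \<Rightarrow> ((nat \<times> nat) list \<times> tree list \<times> tree list) list" where
  "gaps [] = [([], [], [])]"
| "gaps (Node cs # ts) = ([], [], Node cs # ts) #
    map (under ts) (filter (\<lambda>(s, u, r). u \<noteq> [] \<and> r \<noteq> []) (gaps cs)) @ map (push (Node cs)) (gaps ts)"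

fun leaves :: "tree list \<Rightarrow> ((nat \<times> nat) list \<times> tree list \<times> tree list) list" where
  "leaves [] = []"
| "leaves (Node cs # ts) =
    (if cs = [] then [([(0, length ts)], [], ts)] else map (under ts) (leaves cs)) @
    map (push (Node cs)) (leaves ts)"

lemma nodes_take_drop: "nodes (take k F) + nodes (drop k F) = nodes F"
  by (metis append_take_drop_id nodes_append)

lemma nodes_plug: "nodes (plug s u r) = nodes u + nodes r + length s"
proof (induction s u r rule: plug.induct)
  case (2 d b s u r)
  then show ?case
    using nodes_take_drop[of d u] nodes_take_drop[of "length r - b" r] by simp
qed simp

lemma in_push_iff:
  "(s, u, r) \<in> push t ` X \<longleftrightarrow> (\<exists>u'. u = t # u' \<and>
    (s = [] \<and> ([], u', r) \<in> X \<or> (\<exists>d b s'. s = (Suc d, b) # s' \<and> ((d, b) # s', u', r) \<in> X)))"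
proof
  assume "(s, u, r) \<in> push t ` X"
  then obtain s' u' r' where x: "(s, u, r) = push t (s', u', r')" "(s', u', r') \<in> X" by auto
  then show "\<exists>u'. u = t # u' \<and>
    (s = [] \<and> ([], u', r) \<in> X \<or> (\<exists>d b s'. s = (Suc d, b) # s' \<and> ((d, b) # s', u', r) \<in> X))"
    by (cases "(t, s', u', r')" rule: push.cases) auto
next
  assume "\<exists>u'. u = t # u' \<and>
    (s = [] \<and> ([], u', r) \<in> X \<or> (\<exists>d b s'. s = (Suc d, b) # s' \<and> ((d, b) # s', u', r) \<in> X))"
  then show "(s, u, r) \<in> push t ` X"
    by (auto intro: rev_image_eqI)
qed

lemma in_under_iff:
  "(s, u, r) \<in> under ts ` X \<longleftrightarrow> (\<exists>s' r'. s = (0, length ts) # s' \<and> r = r' @ ts \<and> (s', u, r') \<in> X)"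
proof
  assume "(s, u, r) \<in> under ts ` X"
  then show "\<exists>s' r'. s = (0, length ts) # s' \<and> r = r' @ ts \<and> (s', u, r') \<in> X" by auto
next
  assume "\<exists>s' r'. s = (0, length ts) # s' \<and> r = r' @ ts \<and> (s', u, r') \<in> X"
  then show "(s, u, r) \<in> under ts ` X" by (auto intro: rev_image_eqI)
qed

lemma plug_Cons_neq_Nil [simp]: "plug (x # s) u r \<noteq> []"
  by (cases x) simp

text \<open>The bound keeps \<open>length r - b\<close> from being truncated, so that exactly the
  last \<open>b\<close> trees of \<open>r\<close> become right siblings.\<close>

lemma plug_under:
  assumes "b \<le> length r"
  shows "plug ((0, b) # s) u r = Node cs # ts \<longleftrightarrow>
    (\<exists>r'. r = r' @ ts \<and> b = length ts \<and> plug s u r' = cs)"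
proof
  assume *: "plug ((0, b) # s) u r = Node cs # ts"
  then have "drop (length r - b) r = ts" "plug s u (take (length r - b) r) = cs" by simp_all
  moreover from this(1) have "length ts = b" using assms by auto
  ultimately show "\<exists>r'. r = r' @ ts \<and> b = length ts \<and> plug s u r' = cs"
    by (metis append_take_drop_id)
qed auto

text \<open>\<open>plug\<close> undoes a cut. On a nonempty path the first number \<open>d\<close>
  of left siblings tells which clause of \<open>gaps\<close> produced the entry: \<open>0\<close>
  means \<open>under\<close>, a successor means \<open>push\<close>.\<close>

lemma in_gaps_iff: "(s, u, r) \<in> set (gaps F) \<longleftrightarrow> gap_path s (length u) (length r) \<and> plug s u r = F"
proof (induction F arbitrary: s u r rule: gaps.induct)
  case 1
  show ?case by (cases s) (auto simp: gap_path_def)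
next
  case (2 cs ts)
  have mem: "(s, u, r) \<in> set (gaps (Node cs # ts)) \<longleftrightarrow> (s, u, r) = ([], [], Node cs # ts) \<or>
    (s, u, r) \<in> under ts ` {(s, u, r). u \<noteq> [] \<and> r \<noteq> [] \<and> (s, u, r) \<in> set (gaps cs)} \<or>
    (s, u, r) \<in> push (Node cs) ` set (gaps ts)"
    by (auto simp: image_iff)
  show ?case
  proof (cases s)
    case Nil
    then show ?thesis
      unfolding mem in_push_iff in_under_iff using 2(2)
      by (cases u) (auto simp: gap_path_def)
  next
    case (Cons x s')
    obtain d b where x: "x = (d, b)" by (cases x)
    show ?thesis
    proof (cases d)
      case 0
      have "(s, u, r) \<in> set (gaps (Node cs # ts)) \<longleftrightarrow> (\<exists>r'. b = length ts \<and> r = r' @ ts \<and>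
          u \<noteq> [] \<and> r' \<noteq> [] \<and> gap_path s' (length u) (length r') \<and> plug s' u r' = cs)"
        unfolding mem in_push_iff in_under_iff using Cons x 0 2(1) by auto
      also have "\<dots> \<longleftrightarrow> (\<exists>r'. b = length ts \<and> r = r' @ ts \<and>
          gap_path ((0, b) # s') (length u) (length r) \<and> plug s' u r' = cs)"
        by (auto simp: gap_path_def)
      also have "\<dots> \<longleftrightarrow> gap_path ((0, b) # s') (length u) (length r) \<and> plug ((0, b) # s') u r = Node cs # ts"
        using plug_under[of b r s' u cs ts] by (auto simp: gap_path_def simp del: plug.simps)
      finally show ?thesis using Cons x 0 by simp
    next
      case (Suc d')
      show ?thesis
      proof (cases u)
        case Nil
        then show ?thesis unfolding mem in_push_iff in_under_iff using Cons x Suc by (auto simp: gap_path_def)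
      next
        case u: (Cons t u')
        have "(s, u, r) \<in> set (gaps (Node cs # ts)) \<longleftrightarrow> t = Node cs \<and> ((d', b) # s', u', r) \<in> set (gaps ts)"
          unfolding mem in_push_iff in_under_iff using Cons x Suc u by auto
        also have "\<dots> \<longleftrightarrow> gap_path s (length u) (length r) \<and> plug s u r = Node cs # ts"
          unfolding 2(2) using Cons x Suc u by (auto simp: gap_path_def)
        finally show ?thesis .
      qed
    qed
  qed
qed

lemma in_leaves_iff: "(s, u, r) \<in> set (leaves F) \<longleftrightarrow> leaf_path s (length u) (length r) \<and> plug s u r = F"
proof (induction F arbitrary: s u r rule: leaves.induct)
  case 1
  show ?case by (cases s) (auto simp: leaf_path_def)
next
  case (2 cs ts)
  have mem: "(s, u, r) \<in> set (leaves (Node cs # ts)) \<longleftrightarrow>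
    cs = [] \<and> (s, u, r) = ([(0, length ts)], [], ts) \<or>
    cs \<noteq> [] \<and> (s, u, r) \<in> under ts ` set (leaves cs) \<or>
    (s, u, r) \<in> push (Node cs) ` set (leaves ts)"
    by auto
  show ?case
  proof (cases s)
    case Nil
    then show ?thesis
      unfolding mem in_push_iff in_under_iff using 2(2)
      by (auto simp: leaf_path_def)
  next
    case (Cons x s')
    obtain d b where x: "x = (d, b)" by (cases x)
    show ?thesis
    proof (cases d)
      case 0
      \<comment> \<open>Joins both branches of \<open>leaves\<close>: if the path ends here,
        \<open>leaf_path\<close> forces both remaining forests to be empty; otherwise the children
        are nonempty.\<close>
      have *: "cs = [] \<and> s' = [] \<and> u = [] \<and> r' = [] \<or>
          cs \<noteq> [] \<and> leaf_path s' (length u) (length r') \<and> plug s' u r' = cs \<longleftrightarrow>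
          leaf_path ((0, b) # s') (length u) (length r) \<and> plug s' u r' = cs"
        if "b = length ts" "r = r' @ ts" for r'
      proof (cases s')
        case Nil
        with that show ?thesis by (auto simp: leaf_path_def)
      next
        case (Cons y s'')
        then have "plug s' u r' \<noteq> []" by simp
        with that Cons show ?thesis unfolding leaf_path_def by auto
      qed
      have "(s, u, r) \<in> set (leaves (Node cs # ts)) \<longleftrightarrow>
          (\<exists>r'. b = length ts \<and> r = r' @ ts \<and> (cs = [] \<and> s' = [] \<and> u = [] \<and> r' = [] \<or>
            cs \<noteq> [] \<and> leaf_path s' (length u) (length r') \<and> plug s' u r' = cs))"
        unfolding mem in_push_iff in_under_iff using Cons x 0 2(1) by auto
      also have "\<dots> \<longleftrightarrow> (\<exists>r'. b = length ts \<and> r = r' @ ts \<and>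
          leaf_path ((0, b) # s') (length u) (length r) \<and> plug s' u r' = cs)"
        by (rule ex_cong1) (use * in blast)
      also have "\<dots> \<longleftrightarrow> leaf_path ((0, b) # s') (length u) (length r) \<and> plug ((0, b) # s') u r = Node cs # ts"
        using plug_under[of b r s' u cs ts] by (auto simp: leaf_path_def simp del: plug.simps)
      finally show ?thesis using Cons x 0 by simp
    next
      case (Suc d')
      show ?thesis
      proof (cases u)
        case Nil
        then show ?thesis unfolding mem in_push_iff in_under_iff using Cons x Suc by (auto simp: leaf_path_def)
      next
        case u: (Cons t u')
        have "(s, u, r) \<in> set (leaves (Node cs # ts)) \<longleftrightarrow> t = Node cs \<and> ((d', b) # s', u', r) \<in> set (leaves ts)"
          unfolding mem in_push_iff in_under_iff using Cons x Suc u by auto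
        also have "\<dots> \<longleftrightarrow> leaf_path s (length u) (length r) \<and> plug s u r = Node cs # ts"
          unfolding 2(2) using Cons x Suc u by (auto simp: leaf_path_def)
        finally show ?thesis .
      qed
    qed
  qed
qed

section \<open>Cuts of a forest as cuts of its word\<close>

definition sides :: "(nat \<times> nat) list \<times> tree list \<times> tree list \<Rightarrow> nat list \<times> nat list" where
  "sides = (\<lambda>(s, u, r). (word u, word r))"

lemma sides_push: "sides (push t x) = (bracket (word [t]) (fst (sides x)), snd (sides x))"
  using word_append[of "[t]" "fst (snd x)"]
  by (cases "(t, x)" rule: push.cases) (auto simp: sides_def)

lemma sides_under: "sides (under ts x) = (fst (sides x), bracket (snd (sides x)) (word ts))"
  by (cases x) (simp add: sides_def word_append)

text \<open>Word counterpart of the filter in \<open>gaps\<close>: only the cuts at \<open>0\<close>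
  and at \<open>nblocks v\<close> have an empty side.\<close>

lemma filter_low_high_nonempty:
  assumes "is_partition v"
  shows "filter (\<lambda>x. low x v \<noteq> [] \<and> high x v \<noteq> []) [0..<Suc (nblocks v)] = [1..<nblocks v]"
proof (cases "nblocks v = 0")
  case True
  then show ?thesis using low_0[OF assms] by simp
next
  case False
  have "low x v \<noteq> []" if "0 < x" "x \<le> nblocks v" for x
    using nblocks_low[OF assms that(2)] that(1) by auto
  moreover have "high x v \<noteq> []" if "x < nblocks v" for x
    using nblocks_high[of x v] that by fastforce
  moreover have "high (nblocks v) v = []" by (simp add: high_nblocks)
  moreover have "[0..<Suc (nblocks v)] = 0 # [1..<nblocks v] @ [nblocks v]"
    using False by (simp add: upt_conv_Cons)
  ultimately show ?thesis using low_0[OF assms] by (simp add: filter_id_conv)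
qed

text \<open>With \<open>k\<close> blocks in the first tree, \<open>x = 0\<close> is the gap in front
  of it, \<open>1 \<le> x < k\<close> are the gaps inside it, and \<open>x \<ge> k\<close> are those
  of the other trees shifted by \<open>k\<close>. The letters of the path nodes come after the cut
  without exceeding \<open>x\<close>, so they belong to neither side.\<close>

lemma map_sides_gaps:
  "map sides (gaps F) = map (\<lambda>x. (low x (word F), high x (word F))) [0..<Suc (nblocks (word F))]"
proof (induction F rule: gaps.induct)
  case 1
  show ?case by (simp add: sides_def low_def)
next
  case (2 cs ts)
  define v c k w m where "v = word cs" and "c = v @ [1]" and "k = nblocks c"
    and "w = word ts" and "m = nblocks w"
  define h where "h = (\<lambda>x. (low x (bracket c w), high x (bracket c w)))"
  have pv: "is_partition v" and pc: "is_partition c" and pw: "is_partition w"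
    by (simp_all add: v_def c_def w_def)
  have "k \<ge> 1" and kv: "k = max (nblocks v) 1" unfolding k_def c_def by simp_all
  have split: "[0..<Suc (k + m)] = 0 # [1..<k] @ map (\<lambda>x. x + k) [0..<Suc m]"
  proof -
    have "[0..<Suc (k + m)] = [0..<k] @ [k..<Suc m + k]"
      using upt_add_eq_append[of 0 k "Suc m"] by (simp add: add.commute)
    moreover have "[0..<k] = 0 # [1..<k]" using \<open>k \<ge> 1\<close> by (simp add: upt_conv_Cons)
    ultimately show ?thesis by (simp add: map_add_upt add.commute)
  qed
  have inner: "map sides (map (under ts) (filter (\<lambda>(s, u, r). u \<noteq> [] \<and> r \<noteq> []) (gaps cs))) = map h [1..<k]"
  proof -
    have "map sides (filter (\<lambda>(s, u, r). u \<noteq> [] \<and> r \<noteq> []) (gaps cs)) =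
      filter (\<lambda>(a, b). a \<noteq> [] \<and> b \<noteq> []) (map sides (gaps cs))"
      by (auto simp: filter_map comp_def sides_def case_prod_beta intro!: arg_cong[where f = "map _"] filter_cong)
    also have "\<dots> = map (\<lambda>x. (low x v, high x v)) [1..<nblocks v]"
      unfolding 2(1) using filter_low_high_nonempty[OF pv] by (simp add: filter_map comp_def v_def del: upt_Suc)
    also have "[1..<nblocks v] = [1..<k]" by (simp add: kv max_def)
    finally have *: "map sides (filter (\<lambda>(s, u, r). u \<noteq> [] \<and> r \<noteq> []) (gaps cs)) =
      map (\<lambda>x. (low x v, high x v)) [1..<k]" .
    have **: "map sides (map (under ts) X) = map (\<lambda>y. (fst y, bracket (snd y) w)) (map sides X)" for X
      by (simp add: comp_def sides_under w_def)
    have "map sides (map (under ts) (filter (\<lambda>(s, u, r). u \<noteq> [] \<and> r \<noteq> []) (gaps cs))) =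
      map (\<lambda>x. (low x v, bracket (high x v) w)) [1..<k]"
      unfolding ** * by simp
    moreover have "h x = (low x v, bracket (high x v) w)" if "x \<in> set [1..<k]" for x
    proof -
      have x: "1 \<le> x" "x < k" "x < nblocks v" using that by (auto simp: kv)
      then show ?thesis
        using low_bracket_less[OF pc pw] high_bracket_le[OF pw, of x c] low_snoc_1[of x v] high_snoc_1[of x v]
        by (simp add: h_def k_def c_def)
    qed
    ultimately show ?thesis by simp
  qed
  have outer: "map sides (map (push (Node cs)) (gaps ts)) = map h (map (\<lambda>x. x + k) [0..<Suc m])"
  proof -
    have "map sides (map (push (Node cs)) (gaps ts)) = map (\<lambda>y. (bracket c (fst y), snd y)) (map sides (gaps ts))"
      by (simp add: comp_def sides_push c_def v_def)
    also have "\<dots> = map h (map (\<lambda>x. x + k) [0..<Suc m])"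
      unfolding 2(2) by (simp add: comp_def h_def k_def m_def w_def low_bracket_ge high_bracket_ge del: upt_Suc)
    finally show ?thesis .
  qed
  have "sides ([], [], Node cs # ts) = h 0"
    using is_partition_bracket[OF pc pw] by (simp add: sides_def h_def low_0 high_0 c_def v_def w_def)
  then have "map sides (gaps (Node cs # ts)) = map h [0..<Suc (k + m)]"
    unfolding split gaps.simps list.map map_append inner outer by simp
  then show ?case by (simp add: h_def k_def m_def c_def v_def w_def del: upt_Suc)
qed

text \<open>A leaf belongs to neither side, and it opens the block with letter \<open>x + 1\<close>.
  Hence \<open>high\<close> starts one letter later than at a gap.\<close>

lemma map_sides_leaves:
  "map sides (leaves F) = map (\<lambda>x. (low x (word F), high (Suc x) (word F))) [0..<nblocks (word F)]"
proof (induction F rule: leaves.induct)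
  case 1
  show ?case by simp
next
  case (2 cs ts)
  define v c k w m where "v = word cs" and "c = v @ [1]" and "k = nblocks c"
    and "w = word ts" and "m = nblocks w"
  define h where "h = (\<lambda>x. (low x (bracket c w), high (Suc x) (bracket c w)))"
  have pv: "is_partition v" and pc: "is_partition c" and pw: "is_partition w"
    by (simp_all add: v_def c_def w_def)
  have kv: "k = max (nblocks v) 1" unfolding k_def c_def by simp
  have split: "[0..<k + m] = [0..<k] @ map (\<lambda>x. x + k) [0..<m]"
    using upt_add_eq_append[of 0 k m] by (simp add: map_add_upt add.commute)
  have inner: "map sides (if cs = [] then [([(0, length ts)], [], ts)] else map (under ts) (leaves cs)) = map h [0..<k]"
  \<comment> \<open>For \<open>cs = []\<close> the root itself is the leaf and contributes the only
    block of its tree.\<close>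
  proof (cases "cs = []")
    case True
    then have "c = [1]" "k = 1" by (simp_all add: c_def v_def k_def)
    moreover have "high 1 [1] = []" by (simp add: high_def)
    ultimately have "h 0 = ([], w)"
      using high_bracket_le[OF pw, of 1 c] low_0[OF is_partition_bracket[OF pc pw]] by (simp add: h_def k_def)
    with True \<open>k = 1\<close> show ?thesis by (simp add: sides_def w_def)
  next
    case False
    then have "v \<noteq> []" by (simp add: v_def)
    then have "{1..nblocks v} \<noteq> {}" using is_partition_set[OF pv] by (metis set_empty)
    then have "nblocks v \<noteq> 0" by simp
    then have k: "k = nblocks v" by (simp add: kv)
    have "map sides (map (under ts) (leaves cs)) = map (\<lambda>y. (fst y, bracket (snd y) w)) (map sides (leaves cs))"
      by (simp add: comp_def sides_under w_def)
    also have "\<dots> = map (\<lambda>x. (low x v, bracket (high (Suc x) v) w)) [0..<k]"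
      unfolding 2(1)[OF False] by (simp add: k v_def)
    also have "\<dots> = map h [0..<k]"
      using low_bracket_less[OF pc pw] high_bracket_le[OF pw, of _ c] low_snoc_1[of _ v] high_snoc_1[of _ v] k
      by (auto simp: h_def k_def c_def)
    finally show ?thesis using False by simp
  qed
  have outer: "map sides (map (push (Node cs)) (leaves ts)) = map h (map (\<lambda>x. x + k) [0..<m])"
  proof -
    have "map sides (map (push (Node cs)) (leaves ts)) = map (\<lambda>y. (bracket c (fst y), snd y)) (map sides (leaves ts))"
      by (simp add: comp_def sides_push c_def v_def)
    also have "\<dots> = map h (map (\<lambda>x. x + k) [0..<m])"
      unfolding 2(2) by (simp add: comp_def h_def k_def m_def w_def low_bracket_ge high_bracket_ge Suc_diff_le)
    finally show ?thesis .
  qed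
  have "map sides (leaves (Node cs # ts)) = map h [0..<k + m]"
    unfolding split leaves.simps map_append inner outer by simp
  then show ?case by (simp add: h_def k_def m_def c_def v_def w_def)
qed

section \<open>Counting\<close>

text \<open>The Euler characteristic count, arranged with sums only so that natural numbers suffice:
  \<open>p\<close> holds on an initial segment and \<open>q\<close> on a final one.\<close>

lemma cut_telescope:
  fixes p q :: "nat \<Rightarrow> bool"
  assumes p: "\<And>x. p (Suc x) \<Longrightarrow> p x" and q: "\<And>x. q x \<Longrightarrow> q (Suc x)"
  shows "of_bool (\<forall>x\<le>n. p x \<or> q x) + card {x. x \<le> n \<and> p x \<and> q x} =
    of_bool (p n) + of_bool (q 0) + card {x. x < n \<and> p x \<and> q (Suc x)}"
proof (induction n)
  case 0
  have "{x. x = 0 \<and> p x \<and> q x} = (if p 0 \<and> q 0 then {0} else {})" by auto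
  then show ?case by auto
next
  case (Suc n)
  have 1: "card {x. x \<le> Suc n \<and> p x \<and> q x} =
      card {x. x \<le> n \<and> p x \<and> q x} + of_bool (p (Suc n) \<and> q (Suc n))"
  proof -
    have "{x. x \<le> Suc n \<and> p x \<and> q x} =
      {x. x \<le> n \<and> p x \<and> q x} \<union> (if p (Suc n) \<and> q (Suc n) then {Suc n} else {})"
      by (auto simp: le_Suc_eq)
    then show ?thesis by (simp add: card_insert_if)
  qed
  have 2: "card {x. x < Suc n \<and> p x \<and> q (Suc x)} =
      card {x. x < n \<and> p x \<and> q (Suc x)} + of_bool (p n \<and> q (Suc n))"
  proof -
    have "{x. x < Suc n \<and> p x \<and> q (Suc x)} =
      {x. x < n \<and> p x \<and> q (Suc x)} \<union> (if p n \<and> q (Suc n) then {n} else {})"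
      by (auto simp: less_Suc_eq)
    then show ?thesis by (simp add: card_insert_if)
  qed
  have 3: "(\<forall>x\<le>Suc n. p x \<or> q x) \<longleftrightarrow> (\<forall>x\<le>n. p x \<or> q x) \<and> (p (Suc n) \<or> q (Suc n))"
    by (auto simp: le_Suc_eq)
  \<comment> \<open>If \<open>q\<close> fails at \<open>Suc n\<close>, it fails at all earlier
    points, so covering them rests on \<open>p\<close> alone.\<close>
  have 4: "(\<forall>x\<le>n. p x \<or> q x) \<longleftrightarrow> p n" if "\<not> q (Suc n)"
  proof -
    have "\<not> q x" if "x \<le> n" for x
      using lift_Suc_mono_le[of q, OF le_boolI] q that \<open>\<not> q (Suc n)\<close> by (metis le_SucI le_boolE)
    moreover have "p x" if "p n" "x \<le> n" for x
      using that(2,1) by (induction rule: inc_induct) (auto intro: p)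
    ultimately show ?thesis by auto
  qed
  show ?case
    unfolding 1 2 3 using Suc 4 p[of n] by (cases "q (Suc n)"; cases "p n"; cases "p (Suc n)") auto
qed

section \<open>The cut identity for a single forest\<close>

definition avoiders :: "nat list \<Rightarrow> tree list set" where
  "avoiders \<sigma> = {F. avoids (word F) \<sigma>}"

text \<open>\<open>low x\<close> of the word has exactly \<open>x\<close> blocks, so different cuts
  have different sides. Distinctness lets list lengths be read as cardinalities.\<close>

lemma distinct_gaps: "distinct (gaps F)"
proof -
  have "inj_on (\<lambda>x. (low x (word F), high x (word F))) {0..<Suc (nblocks (word F))}"
    by (rule inj_onI) (metis Pair_inject atLeastLessThan_iff is_partition_word less_Suc_eq_le nblocks_low)
  then have "distinct (map sides (gaps F))"
    unfolding map_sides_gaps by (simp add: distinct_map del: upt_Suc)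
  then show ?thesis by (simp add: distinct_map)
qed

lemma distinct_leaves: "distinct (leaves F)"
proof -
  have "inj_on (\<lambda>x. (low x (word F), high (Suc x) (word F))) {0..<nblocks (word F)}"
    by (rule inj_onI) (metis Pair_inject atLeastLessThan_iff is_partition_word less_imp_le nblocks_low)
  then have "distinct (map sides (leaves F))"
    unfolding map_sides_leaves by (simp add: distinct_map)
  then show ?thesis by (simp add: distinct_map)
qed

lemma card_filter_sides:
  assumes "distinct xs" "map sides xs = map g [0..<n]"
  shows "card {t \<in> set xs. Q (sides t)} = card {x. x < n \<and> Q (g x)}"
proof -
  have "card {t \<in> set xs. Q (sides t)} = length (filter (Q \<circ> sides) xs)"
    using assms(1) by (simp add: distinct_length_filter Int_def conj_commute)
  also have "\<dots> = length (filter Q (map sides xs))" by (simp add: filter_map)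
  also have "\<dots> = length (filter (Q \<circ> g) [0..<n])" unfolding assms(2) by (simp add: filter_map)
  also have "\<dots> = card {x. x < n \<and> Q (g x)}"
    by (simp add: distinct_length_filter Int_def conj_commute)
  finally show ?thesis .
qed

lemma avoiders_bracket_cut:
  assumes "is_partition \<beta>"
  shows "of_bool (F \<in> avoiders (bracket \<alpha> \<beta>)) +
      card {(s, u, r). (s, u, r) \<in> set (gaps F) \<and> u \<in> avoiders \<alpha> \<and> r \<in> avoiders \<beta>} =
    of_bool (F \<in> avoiders \<alpha>) + of_bool (F \<in> avoiders \<beta>) +
      card {(s, u, r). (s, u, r) \<in> set (leaves F) \<and> u \<in> avoiders \<alpha> \<and> r \<in> avoiders \<beta>}"
proof -
  define w n where "w = word F" and "n = nblocks w"
  define p q where "p = (\<lambda>x. avoids (low x w) \<alpha>)" and "q = (\<lambda>x. avoids (high x w) \<beta>)"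
  define Q where "Q = (\<lambda>(a, b). avoids a \<alpha> \<and> avoids b \<beta>)"
  have sides: "{(s, u, r). (s, u, r) \<in> set xs \<and> u \<in> avoiders \<alpha> \<and> r \<in> avoiders \<beta>} =
    {t \<in> set xs. Q (sides t)}" for xs
    by (auto simp: Q_def sides_def avoiders_def)
  have "F \<in> avoiders (bracket \<alpha> \<beta>) \<longleftrightarrow> (\<forall>x\<le>n. p x \<or> q x)"
    using contains_bracket_iff[OF noncrossing_word assms, of F \<alpha>]
    by (auto simp: avoiders_def avoids_def p_def q_def n_def w_def)
  moreover have "card {t \<in> set (gaps F). Q (sides t)} = card {x. x \<le> n \<and> p x \<and> q x}"
    using card_filter_sides[OF distinct_gaps map_sides_gaps, of F Q]
    by (simp add: Q_def p_def q_def n_def w_def less_Suc_eq_le)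
  moreover have "card {t \<in> set (leaves F). Q (sides t)} = card {x. x < n \<and> p x \<and> q (Suc x)}"
    using card_filter_sides[OF distinct_leaves map_sides_leaves, of F Q]
    by (simp add: Q_def p_def q_def n_def w_def)
  \<comment> \<open>Cutting at \<open>n\<close> leaves the whole word below the cut, cutting at
    \<open>0\<close> leaves all of it above.\<close>
  moreover have "F \<in> avoiders \<alpha> \<longleftrightarrow> p n" "F \<in> avoiders \<beta> \<longleftrightarrow> q 0"
    by (simp_all add: avoiders_def p_def q_def n_def w_def low_nblocks high_0)
  moreover have "p (Suc x) \<Longrightarrow> p x" "q x \<Longrightarrow> q (Suc x)" for x
    using contains_subseq[OF _ subseq_low_mono[of x "Suc x" w]] contains_high_mono[of x "Suc x" w]
    by (auto simp: p_def q_def avoids_def)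
  ultimately show ?thesis unfolding sides using cut_telescope[of p q n] by simp
qed

section \<open>Summation over forests of given size and number of trees\<close>

definition forests :: "nat \<Rightarrow> nat \<Rightarrow> tree list set" where
  "forests n c = {F. nodes F = n \<and> length F = c}"

lemma finite_forests_Int [simp]: "finite (forests n c)" "finite (A \<inter> forests n c)"
  using finite_forests[of n] by (auto simp: forests_def intro: finite_subset[rotated])

text \<open>The number of trees of \<open>plug s u r\<close> when \<open>u\<close> and
  \<open>r\<close> are long enough. On a nonempty path \<open>Suc\<close> counts the first path
  node, the other top-level trees being its siblings.\<close>

fun width :: "(nat \<times> nat) list \<Rightarrow> nat \<Rightarrow> nat \<Rightarrow> nat" where
  "width [] i j = i + j"
| "width ((d, b) # s) i j = Suc (d + b)"

lemma length_plug:
  assumes "s = [] \<or> lefts s \<le> length u \<and> rights s \<le> length r"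
  shows "length (plug s u r) = width s (length u) (length r)"
  using assms by (cases "(s, u, r)" rule: plug.cases) auto

text \<open>Apart from membership in \<open>A\<close> and \<open>B\<close>, the conditions see
  \<open>u\<close> and \<open>r\<close> only through size and length. This makes the counts depend
  only on how many forests of each kind \<open>A\<close> and \<open>B\<close> contain.\<close>

definition cuts :: "((nat \<times> nat) list \<Rightarrow> nat \<Rightarrow> nat \<Rightarrow> bool) \<Rightarrow> tree list set \<Rightarrow> tree list set \<Rightarrow>
    nat \<Rightarrow> nat \<Rightarrow> ((nat \<times> nat) list \<times> tree list \<times> tree list) set" where
  "cuts ok A B n c = {(s, u, r). ok s (length u) (length r) \<and> u \<in> A \<and> r \<in> B \<and>
     nodes u + nodes r + length s = n \<and> width s (length u) (length r) = c}"

lemma card_cuts: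
  assumes "\<And>s u r F. (s, u, r) \<in> set (L F) \<longleftrightarrow> ok s (length u) (length r) \<and> plug s u r = F"
    and "\<And>s i j. ok s i j \<Longrightarrow> s = [] \<or> lefts s \<le> i \<and> rights s \<le> j"
  shows "card (cuts ok A B n c) =
    (\<Sum>F\<in>forests n c. card {(s, u, r). (s, u, r) \<in> set (L F) \<and> u \<in> A \<and> r \<in> B})"
proof -
  define X where "X F = {(s, u, r). (s, u, r) \<in> set (L F) \<and> u \<in> A \<and> r \<in> B}" for F
  have "cuts ok A B n c = (\<Union>F\<in>forests n c. X F)"
    using assms(2) length_plug by (fastforce simp: cuts_def forests_def X_def assms(1) nodes_plug)
  moreover have "finite (X F)" for F
    by (rule finite_subset[of _ "set (L F)"]) (auto simp: X_def)
  moreover have "X F \<inter> X G = {}" if "F \<noteq> G" for F G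
    using that by (auto simp: X_def assms(1))
  ultimately have "card (cuts ok A B n c) = (\<Sum>F\<in>forests n c. card (X F))"
    by (simp add: card_UN_disjoint)
  then show ?thesis by (simp add: X_def)
qed

text \<open>Only the first term involves the bracket, so symmetry and congruence of the other terms
  pass to it.\<close>

lemma card_avoiders_bracket:
  assumes "is_partition \<beta>"
  shows "card (avoiders (bracket \<alpha> \<beta>) \<inter> forests n c) + card (cuts gap_path (avoiders \<alpha>) (avoiders \<beta>) n c) =
    card (avoiders \<alpha> \<inter> forests n c) + card (avoiders \<beta> \<inter> forests n c) +
      card (cuts leaf_path (avoiders \<alpha>) (avoiders \<beta>) n c)"
proof -
  have count: "card (A \<inter> forests n c) = (\<Sum>F\<in>forests n c. of_bool (F \<in> A))" for A
    by (simp add: sum.If_cases of_bool_def Int_commute)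
  have gap: "card (cuts gap_path A B n c) =
    (\<Sum>F\<in>forests n c. card {(s, u, r). (s, u, r) \<in> set (gaps F) \<and> u \<in> A \<and> r \<in> B})" for A B
    by (rule card_cuts[OF in_gaps_iff]) (auto simp: gap_path_def)
  have leaf: "card (cuts leaf_path A B n c) =
    (\<Sum>F\<in>forests n c. card {(s, u, r). (s, u, r) \<in> set (leaves F) \<and> u \<in> A \<and> r \<in> B})" for A B
    by (rule card_cuts[OF in_leaves_iff]) (auto simp: leaf_path_def)
  show ?thesis
    unfolding count gap leaf sum.distrib[symmetric] using avoiders_bracket_cut[OF assms] by simp
qed

section \<open>Equinumerous families of forests\<close>

definition equinumerous :: "tree list set \<Rightarrow> tree list set \<Rightarrow> bool" where
  "equinumerous A B \<longleftrightarrow> (\<forall>n c. card (A \<inter> forests n c) = card (B \<inter> forests n c))"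

lemma equinumerous_refl [simp]: "equinumerous A A"
  by (simp add: equinumerous_def)

lemma equinumerous_trans [trans]: "equinumerous A B \<Longrightarrow> equinumerous B C \<Longrightarrow> equinumerous A C"
  by (simp add: equinumerous_def)

lemma equinumerous_bij:
  assumes "equinumerous A B"
  obtains h where "bij_betw h A B" "\<And>F. F \<in> A \<Longrightarrow> nodes (h F) = nodes F"
    "\<And>F. F \<in> A \<Longrightarrow> length (h F) = length F"
proof -
  have "\<exists>h. bij_betw h (A \<inter> forests n c) (B \<inter> forests n c)" for n c
    using assms by (intro finite_same_card_bij) (auto simp: equinumerous_def)
  then obtain H where H: "\<And>n c. bij_betw (H n c) (A \<inter> forests n c) (B \<inter> forests n c)" by metis
  \<comment> \<open>The bijections between the finite pieces are glued: a forest selects its piece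
    by its own size and number of trees.\<close>
  define h where "h F = H (nodes F) (length F) F" for F
  have h: "h F \<in> B \<and> nodes (h F) = nodes F \<and> length (h F) = length F" if "F \<in> A" for F
    using bij_betw_apply[OF H[of "nodes F" "length F"], of F] that by (simp add: h_def forests_def)
  moreover have "bij_betw h A B"
  proof (rule bij_betw_imageI)
    show "inj_on h A"
    proof (rule inj_onI)
      fix F G assume FG: "F \<in> A" "G \<in> A" "h F = h G"
      then have eq: "nodes F = nodes G" "length F = length G" using h by metis+
      with FG(3) have "H (nodes G) (length G) F = H (nodes G) (length G) G" by (simp add: h_def)
      then show "F = G"
        using bij_betw_imp_inj_on[OF H[of "nodes G" "length G"]] FG(1,2) eq
        by (auto simp: forests_def dest: inj_onD)
    qed
    show "h ` A = B"
    proof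
      show "h ` A \<subseteq> B" using h by blast
      show "B \<subseteq> h ` A"
      proof
        fix G assume "G \<in> B"
        then have "G \<in> H (nodes G) (length G) ` (A \<inter> forests (nodes G) (length G))"
          unfolding bij_betw_imp_surj_on[OF H] by (simp add: forests_def)
        then obtain F where "F \<in> A" "nodes F = nodes G" "length F = length G"
          "G = H (nodes G) (length G) F" by (auto simp: forests_def)
        then show "G \<in> h ` A" by (auto simp: h_def intro: rev_image_eqI)
      qed
    qed
  qed
  ultimately show ?thesis using that by blast
qed

text \<open>Replacing \<open>r\<close> by a partner of equal size and length respects every
  condition in \<open>cuts\<close>. Varying the second family is enough for the final
  induction.\<close>

lemma card_cuts_cong:
  assumes "equinumerous B B'"
  shows "card (cuts ok A B n c) = card (cuts ok A B' n c)"
proof -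
  obtain h where h: "bij_betw h B B'" "\<And>F. F \<in> B \<Longrightarrow> nodes (h F) = nodes F"
    "\<And>F. F \<in> B \<Longrightarrow> length (h F) = length F"
    using equinumerous_bij[OF assms] by blast
  have "bij_betw (\<lambda>(s, u, r). (s, u, h r)) (cuts ok A B n c) (cuts ok A B' n c)"
  proof (rule bij_betw_imageI)
    show "inj_on (\<lambda>(s, u, r). (s, u, h r)) (cuts ok A B n c)"
      using bij_betw_imp_inj_on[OF h(1)] by (auto simp: inj_on_def cuts_def)
    show "(\<lambda>(s, u, r). (s, u, h r)) ` cuts ok A B n c = cuts ok A B' n c"
    proof (intro equalityI subsetI)
      fix t assume "t \<in> (\<lambda>(s, u, r). (s, u, h r)) ` cuts ok A B n c"
      then show "t \<in> cuts ok A B' n c"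
        using h bij_betw_apply[OF h(1)] by (auto simp: cuts_def)
    next
      fix t assume t: "t \<in> cuts ok A B' n c"
      obtain s u r' where t': "t = (s, u, r')" by (cases t)
      with t have "r' \<in> h ` B" using bij_betw_imp_surj_on[OF h(1)] by (auto simp: cuts_def)
      then obtain r where r: "r \<in> B" "r' = h r" by blast
      with t t' h have "(s, u, r) \<in> cuts ok A B n c" by (auto simp: cuts_def)
      with t' r show "t \<in> (\<lambda>(s, u, r). (s, u, h r)) ` cuts ok A B n c"
        by (auto intro: rev_image_eqI)
    qed
  qed
  then show ?thesis by (rule bij_betw_same_card)
qed

lemma lefts_swap [simp]: "lefts (map prod.swap s) = rights s"
  by (simp add: lefts_def rights_def comp_def)

lemma rights_swap [simp]: "rights (map prod.swap s) = lefts s"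
  by (simp add: lefts_def rights_def comp_def)

lemma width_swap [simp]: "width (map prod.swap s) j i = width s i j"
  by (cases "(s, i, j)" rule: width.cases) auto

text \<open>The two forests trade places unchanged; only the sibling numbers along the path are
  exchanged, so no tree is reflected.\<close>

lemma card_cuts_swap:
  assumes "\<And>s i j. ok (map prod.swap s) j i \<longleftrightarrow> ok s i j"
  shows "card (cuts ok A B n c) = card (cuts ok B A n c)"
proof (rule bij_betw_same_card)
  show "bij_betw (\<lambda>(s, u, r). (map prod.swap s, r, u)) (cuts ok A B n c) (cuts ok B A n c)"
    by (rule bij_betw_byWitness[where f' = "\<lambda>(s, u, r). (map prod.swap s, r, u)"])
      (auto simp: cuts_def assms comp_def)
qed

section \<open>Commutativity and congruence of the bracket\<close>

lemma avoiders_bracket_commute: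
  assumes "is_partition \<alpha>" "is_partition \<beta>"
  shows "equinumerous (avoiders (bracket \<alpha> \<beta>)) (avoiders (bracket \<beta> \<alpha>))"
  unfolding equinumerous_def
proof (intro allI)
  fix n c
  have "card (cuts gap_path (avoiders \<alpha>) (avoiders \<beta>) n c) = card (cuts gap_path (avoiders \<beta>) (avoiders \<alpha>) n c)"
    by (rule card_cuts_swap) (auto simp: gap_path_def)
  moreover have "card (cuts leaf_path (avoiders \<alpha>) (avoiders \<beta>) n c) = card (cuts leaf_path (avoiders \<beta>) (avoiders \<alpha>) n c)"
    by (rule card_cuts_swap) (auto simp: leaf_path_def)
  ultimately show "card (avoiders (bracket \<alpha> \<beta>) \<inter> forests n c) = card (avoiders (bracket \<beta> \<alpha>) \<inter> forests n c)"
    using card_avoiders_bracket[OF assms(2), of \<alpha> n c] card_avoiders_bracket[OF assms(1), of \<beta> n c] by linarith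
qed

lemma avoiders_bracket_cong:
  assumes "is_partition \<beta>" "is_partition \<beta>'" "equinumerous (avoiders \<beta>) (avoiders \<beta>')"
  shows "equinumerous (avoiders (bracket \<alpha> \<beta>)) (avoiders (bracket \<alpha> \<beta>'))"
  unfolding equinumerous_def
proof (intro allI)
  fix n c
  have "card (avoiders \<beta> \<inter> forests n c) = card (avoiders \<beta>' \<inter> forests n c)"
    using assms(3) by (simp add: equinumerous_def)
  then show "card (avoiders (bracket \<alpha> \<beta>) \<inter> forests n c) = card (avoiders (bracket \<alpha> \<beta>') \<inter> forests n c)"
    using card_avoiders_bracket[OF assms(1), of \<alpha> n c] card_avoiders_bracket[OF assms(2), of \<alpha> n c]
      card_cuts_cong[OF assms(3), of gap_path "avoiders \<alpha>" n c]
      card_cuts_cong[OF assms(3), of leaf_path "avoiders \<alpha>" n c] by linarith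
qed

text \<open>By associativity, one use of commutativity exchanges the factors formed from
  \<open>xs\<close> and from \<open>\<sigma> # ys\<close>, which rotates \<sigma> to the front. The
  induction hypothesis then enters through congruence in the second factor.\<close>

lemma avoiders_iter_bracket_mset:
  assumes "mset \<sigma>s = mset \<tau>s" "\<forall>\<sigma>\<in>set \<sigma>s. is_partition \<sigma>"
  shows "equinumerous (avoiders (iter_bracket \<sigma>s)) (avoiders (iter_bracket \<tau>s))"
  using assms
proof (induction \<sigma>s arbitrary: \<tau>s)
  case Nil
  then show ?case by simp
next
  case (Cons \<sigma> \<sigma>s)
  have "\<sigma> \<in> set \<tau>s" using Cons.prems(1) by (metis list.set_intros(1) mset_eq_setD)
  then obtain xs ys where \<tau>s: "\<tau>s = xs @ \<sigma> # ys" using split_list by metis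
  with Cons.prems(1) have mset: "mset \<sigma>s = mset (ys @ xs)" by simp
  then have "set (ys @ xs) = set \<sigma>s" by (metis mset_eq_setD)
  with Cons.prems(2) have parts: "\<forall>c\<in>set \<sigma>s. is_partition c" "\<forall>c\<in>set (ys @ xs). is_partition c"
    "\<forall>c\<in>set xs. is_partition c" "\<forall>c\<in>set (\<sigma> # ys). is_partition c" by auto
  have "equinumerous (avoiders (bracket \<sigma> (iter_bracket \<sigma>s))) (avoiders (bracket \<sigma> (iter_bracket (ys @ xs))))"
    using Cons.IH[OF mset parts(1)] parts(1,2) by (intro avoiders_bracket_cong is_partition_iter_bracket)
  also have "bracket \<sigma> (iter_bracket (ys @ xs)) = bracket (iter_bracket (\<sigma> # ys)) (iter_bracket xs)"
    by (simp add: bracket_assoc)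
  also have "equinumerous (avoiders \<dots>) (avoiders (bracket (iter_bracket xs) (iter_bracket (\<sigma> # ys))))"
    using parts(3,4) by (intro avoiders_bracket_commute is_partition_iter_bracket)
  finally show ?case by (simp add: \<tau>s)
qed

section \<open>Back to non-crossing partitions\<close>

lemma Av_nc_eq: "Av_nc \<sigma> = word ` avoiders \<sigma>"
proof (intro equalityI subsetI)
  fix w assume "w \<in> Av_nc \<sigma>"
  then have "noncrossing w" "avoids w \<sigma>" by (auto simp: Av_nc_def noncrossing_def)
  with noncrossing_imp_word[of w] show "w \<in> word ` avoiders \<sigma>" by (auto simp: avoiders_def)
next
  fix w assume "w \<in> word ` avoiders \<sigma>"
  then show "w \<in> Av_nc \<sigma>"
    using noncrossing_word by (auto simp: Av_nc_def avoiders_def noncrossing_def)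
qed

lemma equinumerous_imp_cc_equivalent:
  assumes "equinumerous (avoiders \<sigma>) (avoiders \<tau>)"
  shows "cc_equivalent \<sigma> \<tau>"
proof -
  obtain h where h: "bij_betw h (avoiders \<sigma>) (avoiders \<tau>)"
    "\<And>F. F \<in> avoiders \<sigma> \<Longrightarrow> nodes (h F) = nodes F" "\<And>F. F \<in> avoiders \<sigma> \<Longrightarrow> length (h F) = length F"
    using equinumerous_bij[OF assms] by blast
  have word: "bij_betw word (avoiders \<rho>) (Av_nc \<rho>)" for \<rho>
    unfolding Av_nc_eq by (rule inj_on_imp_bij_betw) (simp add: inj_on_def)
  have "bij_betw (word \<circ> (h \<circ> inv word)) (Av_nc \<sigma>) (Av_nc \<tau>)"
  proof (intro bij_betw_trans[OF _ word] bij_betw_trans[OF _ h(1)])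
    show "bij_betw (inv word) (Av_nc \<sigma>) (avoiders \<sigma>)"
      by (rule bij_betw_byWitness[where f' = word]) (auto simp: Av_nc_eq inv_f_f[OF inj_word])
  qed
  moreover have "length ((word \<circ> (h \<circ> inv word)) \<pi>) = length \<pi> \<and>
      ncomponents ((word \<circ> (h \<circ> inv word)) \<pi>) = ncomponents \<pi>" if "\<pi> \<in> Av_nc \<sigma>" for \<pi>
    using that h by (auto simp: Av_nc_eq inv_f_f[OF inj_word] ncomponents_word)
  ultimately show ?thesis unfolding cc_equivalent_def by blast
qed

theorem theorem3p4:
  fixes \<sigma>s :: "nat list list" and p :: "nat \<Rightarrow> nat"
  assumes "\<forall>\<sigma>\<in>set \<sigma>s. noncrossing \<sigma>"
    and "p permutes {..<length \<sigma>s}"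
  shows "cc_equivalent (iter_bracket \<sigma>s) (iter_bracket (map (\<lambda>i. \<sigma>s ! p i) [0..<length \<sigma>s]))"
proof (intro equinumerous_imp_cc_equivalent avoiders_iter_bracket_mset)
  show "mset \<sigma>s = mset (map (\<lambda>i. \<sigma>s ! p i) [0..<length \<sigma>s])"
    using mset_permute_list[OF assms(2)] by (simp add: permute_list_def)
  show "\<forall>\<sigma>\<in>set \<sigma>s. is_partition \<sigma>" using assms(1) by (simp add: noncrossing_def)
qed

end
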